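(* Let $d>4$ and let $(X_i,Y_i)_{i\ge1}$ be i.i.d. with $Y_i=f_*(X_i)+\mathcal{E}_i$, where $f_*:\mathbb{R}^d\to\mathbb{R}$ is convex with $\|\nabla f_*\|_\infty<\infty$ and $\mathcal{E}_i$ is independent of $X_i$. Let $X$ and $\mathcal{E}$ denote generic copies of $X_i$ and $\mathcal{E}_i$. Assume: (1) there exist $\alpha,\gamma>0$ such that $\mathbb{E}\exp(\alpha\|X\|_\infty^\gamma)<\infty$; (2) the distribution of $\mathcal{E}$ is $\sigma$-sub-Gaussian for some $\sigma>0$, symmetric about zero, and has a continuous positive density $p_{\mathcal{E}}(\cdot)$ in a neighborhood of $0$. Then one can pick $\delta_n$ of order $\Theta\big(n^{-2/d}(\log n)^{1+3/\gamma}\big)$ so that for any estimator $\widehat g_{n,\delta_n}$ satisfying $$\widehat g_{n,\delta_n}\in\operatorname*{arg\,min}_{f\in\mathcal{F}_n}\left\{\sup_{P\in\mathcal{P}(\mathbb{R}^{d+1}):\,D(P,P_n)\le\delta_n}\mathbb{E}_P\big[|Y-f(X)|\big]\right\},$$ there exists a constant $C>0$ such that $$\mathbb{P}\left(l_1(\widehat g_{n,\delta_n},f_* )>C\,n^{-1/d}(\log n)^{\frac{\gamma+3}{2\gamma}}\right)\to0\qquad\text{as }n\to\infty.$$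
   Context: $\mathcal{P}(\mathbb{R}^m)$ is the set of Borel probability measures on $\mathbb{R}^m$. The empirical distribution is $P_n=\frac1n\sum_{i=1}^n\delta_{(X_i,Y_i)}$. In $\mathbb{E}_P[|Y-f(X)|]$, the vector $(X,Y)\in\mathbb{R}^d\times\mathbb{R}$ has law $P$. The transport cost is $c((x,y),(x',y'))=\|x-x'\|_1$ if $y=y'$ and $+\infty$ otherwise, and $D(\mu,\nu)=\inf\{\mathbb{E}_\pi[c(U,V)]\}$, the infimum being over all couplings $\pi$ of $\mu$ and $\nu$ in $\mathcal{P}(\mathbb{R}^{d+1}\times\mathbb{R}^{d+1})$. For convex $f$, $\|\nabla f\|_\infty:=\sup_{x\in\mathbb{R}^d}\max\{\|g\|_\infty:g\in\partial f(x)\}$, with $\partial f(x)$ the subdifferential. The function class is $\mathcal{F}_n=\{f:\mathbb{R}^d\to\mathbb{R}:\ f\text{ is convex},\ \|\nabla f\|_\infty\le\log n\}$. The empirical $l_1$ loss is $l_1(f,g)=\frac1n\sum_{i=1}^n|f(X_i)-g(X_i)|$. A random variable $W$ is $\sigma$-sub-Gaussian if $\|W\|_{\psi_2}:=\sup_{k\ge1}k^{-1/2}(\mathbb{E}|W-\mathbb{E}W|^k)^{1/k}\le\sigma$. For non-negative sequences, $a_n=O(b_n)$ iff $\limsup_{n\to\infty}a_n/b_n<\infty$, and $a_n=\Theta(b_n)$ iff $a_n=O(b_n)$ and $b_n=O(a_n)$. *)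

theory Defs
  imports "HOL-Probability.Probability" "HOL-Library.Landau_Symbols"
begin

definition subdifferential :: "('a::real_inner \<Rightarrow> real) \<Rightarrow> 'a \<Rightarrow> 'a set" where
  "subdifferential f x = {g. \<forall>y. f y \<ge> f x + g \<bullet> (y - x)}"

(* For a finite convex f the subdifferential at a point is nonempty and compact, so the inner
   supremum is a maximum.  The library's infnorm is the sup-norm of the coordinates. *)
definition grad_sup_norm :: "('a::euclidean_space \<Rightarrow> real) \<Rightarrow> ereal" where
  "grad_sup_norm f = (SUP x. SUP g\<in>subdifferential f x. ereal (infnorm g))"

definition lipschitz_convex_class :: "nat \<Rightarrow> ('a::euclidean_space \<Rightarrow> real) set" where
  "lipschitz_convex_class n =
     {f. convex_on UNIV f \<and> grad_sup_norm f \<le> ereal (ln (real n))}"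

definition l1_norm :: "real ^ 'd \<Rightarrow> real" where
  "l1_norm x = (\<Sum>j\<in>UNIV. \<bar>x $ j\<bar>)"

definition transport_cost :: "(real ^ 'd) \<times> real \<Rightarrow> (real ^ 'd) \<times> real \<Rightarrow> ennreal" where
  "transport_cost u v =
     (if snd u = snd v then ennreal (l1_norm (fst u - fst v)) else \<infinity>)"

(* space (prob_algebra borel) is the set of all Borel probability measures on the type. *)
definition couplings ::
    "'a::topological_space measure \<Rightarrow> 'a measure \<Rightarrow> ('a \<times> 'a) measure set" where
  "couplings \<mu> \<nu> =
     {\<pi> \<in> space (prob_algebra borel). distr \<pi> borel fst = \<mu> \<and> distr \<pi> borel snd = \<nu>}"

definition transport_dist ::
    "((real ^ 'd) \<times> real) measure \<Rightarrow> ((real ^ 'd) \<times> real) measure \<Rightarrow> ennreal" where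
  "transport_dist \<mu> \<nu> = (INF \<pi>\<in>couplings \<mu> \<nu>. \<integral>\<^sup>+ (u, v). transport_cost u v \<partial>\<pi>)"

(* The law of z I for I uniform on {1..n}, that is, the average of the point masses at
   z 1, ..., z n; only meaningful for n > 0. *)
definition empirical_measure :: "nat \<Rightarrow> (nat \<Rightarrow> 'a::topological_space) \<Rightarrow> 'a measure" where
  "empirical_measure n z = distr (uniform_count_measure {1..n}) borel z"

(* The expectations are of nonnegative functions, so they are taken as elements of [0, \<infinity>]. *)
definition worst_case_risk ::
    "real \<Rightarrow> ((real ^ 'd) \<times> real) measure \<Rightarrow> (real ^ 'd \<Rightarrow> real) \<Rightarrow> ennreal" where
  "worst_case_risk \<delta> Q f =
     (SUP P\<in>{P \<in> space (prob_algebra borel). transport_dist P Q \<le> ennreal \<delta>}.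
        \<integral>\<^sup>+ (x, y). ennreal \<bar>y - f x\<bar> \<partial>P)"

definition empirical_l1_loss ::
    "nat \<Rightarrow> (nat \<Rightarrow> 'a) \<Rightarrow> ('a \<Rightarrow> real) \<Rightarrow> ('a \<Rightarrow> real) \<Rightarrow> real" where
  "empirical_l1_loss n x f g = (\<Sum>i=1..n. \<bar>f (x i) - g (x i)\<bar>) / real n"

(* Infinite moments count as \<infinity>.  If W is not integrable, the k = 1 term is \<infinity>, so the junk
   value of the expectation of W does no harm. *)
definition psi2_norm :: "'w measure \<Rightarrow> ('w \<Rightarrow> real) \<Rightarrow> ereal" where
  "psi2_norm M W = (SUP k\<in>{1::nat..}.
     if integrable M (\<lambda>\<omega>. \<bar>W \<omega> - integral\<^sup>L M W\<bar> ^ k)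
     then ereal (real k powr (- 1 / 2)
            * (LINT \<omega>|M. \<bar>W \<omega> - integral\<^sup>L M W\<bar> ^ k) powr (1 / real k))
     else \<infinity>)"

definition sub_gaussian :: "'w measure \<Rightarrow> ('w \<Rightarrow> real) \<Rightarrow> real \<Rightarrow> bool" where
  "sub_gaussian M W \<sigma> \<longleftrightarrow> psi2_norm M W \<le> ereal \<sigma>"

(* The library's indep_var requires both random variables to have the same type. *)
definition indep_rvs ::
    "'w measure \<Rightarrow> ('w \<Rightarrow> 'a::topological_space) \<Rightarrow> ('w \<Rightarrow> 'b::topological_space) \<Rightarrow> bool" where
  "indep_rvs M V W \<longleftrightarrow> V \<in> borel_measurable M \<and> W \<in> borel_measurable M \<and>
     prob_space.indep_set M {V -` A \<inter> space M | A. A \<in> sets borel}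
                            {W -` B \<inter> space M | B. B \<in> sets borel}"

definition symmetric_about_zero :: "real measure \<Rightarrow> bool" where
  "symmetric_about_zero \<mu> \<longleftrightarrow> distr \<mu> borel uminus = \<mu>"

(* Only the restriction of the measure to the neighbourhood U has to have a density. *)
definition continuous_positive_density_near_zero :: "real measure \<Rightarrow> bool" where
  "continuous_positive_density_near_zero \<mu> \<longleftrightarrow>
     (\<exists>U p. open U \<and> 0 \<in> U \<and> continuous_on U p \<and> (\<forall>t\<in>U. 0 < p t) \<and>
        (\<forall>A\<in>sets borel. A \<subseteq> U \<longrightarrow> emeasure \<mu> A = (\<integral>\<^sup>+ t\<in>A. ennreal (p t) \<partial>lborel)))"

end

theory Submission
  imports Defs "HOL-Real_Asymp.Real_Asymp"
begin

text \<open>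
The estimator minimises a robust objective that lies above the empirical absolute loss, since the
empirical measure belongs to its own transport ball, and that exceeds it by at most \<open>2 \<delta> L\<close> at the
regression function \<open>f\<^sub>0\<close> with Lipschitz constant \<open>L\<close>
(\<open>dro_minimizer_risk_le\<close>).  Once \<open>ln n \<ge> L\<close> this function competes, so the empirical loss of the
estimator exceeds that of \<open>f\<^sub>0\<close> by at most a multiple of \<open>\<delta>\<close>.

Conversely an error \<open>t\<close> in the regression function raises the expected absolute loss.  As the noise is
symmetric with positive density near \<open>0\<close>, the increase is at least \<open>p\<^sub>0 a (|t| - 2 a)\<close> for all small \<open>a\<close>
(\<open>excess_risk_ge\<close>).  Taking for \<open>a\<close> the claimed rate, an excess risk of order \<open>a\<^sup>2\<close> forces a mean error of order
\<open>a\<close> (\<open>l1_loss_bound\<close>).  The radius \<open>\<delta>\<close> is exactly \<open>a\<^sup>2\<close>.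

Empirical and expected loss differ by a centred noise process, which has to be bounded uniformly over
the convex functions with Lipschitz constant \<open>ln n\<close>, because the estimator depends on the
noise.  With high probability the covariates lie in a ball whose radius is of order
\<open>(ln n)^(1/\<gamma>)\<close>.  Rescaling by this radius and by the Lipschitz constant leaves a fixed class of
convex functions on the unit ball.  Its entropy at resolution \<open>\<epsilon>\<close> is of order \<open>\<epsilon>^(- d/2)\<close>
(\<open>unit_convex_class_covering\<close>).  This is proved by passing to the Moreau envelope, a
smooth convex function that determines the original one by a supremum formula, and by recording its rounded
second differences on a grid of mesh \<open>sqrt \<epsilon>\<close>: each of them takes boundedly many values.

The increments of the noise process satisfy Hoeffding's inequality (\<open>subgaussian_noise_process\<close>).  For
\<open>d > 4\<close> the entropy grows so fast that the chaining sum is dominated by its finest scale, which is of order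
\<open>n^(- 2/d)\<close> (\<open>chaining\<close>).  Undoing the rescaling multiplies this by a constant times \<open>(ln n)^(1 + 1/\<gamma>)\<close>, and
the result is at most of order \<open>\<delta>\<close>.
\<close>

section \<open>Subgradients and Lipschitz bounds\<close>

text \<open>A hyperplane separating the point of the graph over \<open>x\<close> from the strict epigraph has a normal with
positive last component, because \<open>f\<close> is finite on the whole space; rescaling this component to one
turns the rest of the normal into minus a subgradient.\<close>

lemma convex_has_subgradient:
  fixes f :: "'a::euclidean_space \<Rightarrow> real"
  assumes f: "convex_on UNIV f"
  shows "\<exists>g. g \<in> subdifferential f x"
proof -
  define T where "T = {(y, s). f y < s}"
  have "convex T"
    unfolding convex_alt T_def
  proof (clarsimp)
    fix y s z t u
    assume h: "f y < s" "f z < t" "0 \<le> u" "u \<le> (1::real)"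
    have "f ((1 - u) *\<^sub>R y + u *\<^sub>R z) \<le> (1 - u) * f y + u * f z"
      using convex_onD[OF f, of u y z] h by simp
    also have "\<dots> < (1 - u) * s + u * t"
    proof (cases "u = 0")
      case False
      then show ?thesis using h by (intro add_le_less_mono mult_left_mono mult_strict_left_mono) auto
    qed (use h in auto)
    finally show "f ((1 - u) *\<^sub>R y + u *\<^sub>R z) < (1 - u) * s + u * t" .
  qed
  moreover have "(x, f x + 1) \<in> T" "(x, f x) \<notin> T" by (auto simp: T_def)
  ultimately have "\<exists>a b. a \<noteq> 0 \<and> (\<forall>v\<in>{(x, f x)}. inner a v \<le> b) \<and> (\<forall>v\<in>T. inner a v \<ge> b)"
    by (intro separating_hyperplane_sets) auto
  then obtain a b where ab: "a \<noteq> 0" "inner a (x, f x) \<le> b" "\<And>v. v \<in> T \<Longrightarrow> inner a v \<ge> b"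
    by blast
  obtain g c where a: "a = (g, c)" by (cases a)
  have sep: "g \<bullet> x + c * f x \<le> g \<bullet> y + c * s" if "f y < s" for y s
    using ab(2) ab(3)[of "(y, s)"] that by (auto simp: a T_def)
  have "c \<ge> 0" using sep[of x "f x + 1"] by (auto simp: algebra_simps)
  moreover have "c \<noteq> 0"
  proof
    assume "c = 0"
    then have "g \<bullet> x \<le> g \<bullet> y" for y using sep[of y "f y + 1"] by simp
    from this[of "x - g"] have "g = 0"
      by (simp add: inner_diff_right) (metis inner_gt_zero_iff not_less)
    with \<open>c = 0\<close> ab(1) a show False by (simp add: zero_prod_def)
  qed
  ultimately have c: "c > 0" by simp
  have "f y \<ge> f x + (- (g /\<^sub>R c)) \<bullet> (y - x)" for y
  proof (rule field_le_epsilon)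
    fix e :: real assume "e > 0"
    then have "g \<bullet> x + c * f x \<le> g \<bullet> y + c * (f y + e)" by (intro sep) simp
    then show "f x + - (g /\<^sub>R c) \<bullet> (y - x) \<le> f y + e"
      using c by (simp add: inner_diff_right field_simps)
  qed
  then show ?thesis unfolding subdifferential_def by blast
qed

lemma inner_le_infnorm_l1_norm:
  fixes g x :: "real ^ 'd"
  shows "g \<bullet> x \<le> infnorm g * l1_norm x"
proof -
  have "g \<bullet> x = (\<Sum>j\<in>UNIV. g $ j * x $ j)" by (simp add: inner_vec_def)
  also have "\<dots> \<le> (\<Sum>j\<in>UNIV. infnorm g * \<bar>x $ j\<bar>)"
  proof (rule sum_mono)
    fix j
    have "g $ j * x $ j \<le> \<bar>g $ j\<bar> * \<bar>x $ j\<bar>" by (metis abs_ge_self abs_mult)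
    also have "\<dots> \<le> infnorm g * \<bar>x $ j\<bar>"
      by (intro mult_right_mono component_le_infnorm_cart) auto
    finally show "g $ j * x $ j \<le> infnorm g * \<bar>x $ j\<bar>" .
  qed
  finally show ?thesis by (simp add: l1_norm_def sum_distrib_left)
qed

lemma l1_norm_le: "l1_norm (x :: real ^ 'd) \<le> real CARD('d) * norm x"
proof -
  have "l1_norm x \<le> (\<Sum>j\<in>(UNIV::'d set). norm x)"
    unfolding l1_norm_def by (intro sum_mono component_le_norm_cart)
  then show ?thesis by simp
qed

lemma l1_norm_minus_commute: "l1_norm (x - y) = l1_norm (y - x)"
  by (simp add: l1_norm_def abs_minus_commute)

text \<open>The sup norm and the \<open>l\<^sub>1\<close> norm are dual, so a bound on subgradients in the former is a Lipschitz bound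
in the latter, which is the metric of the transport cost.\<close>

lemma grad_sup_norm_imp_lipschitz:
  fixes f :: "real ^ 'd \<Rightarrow> real"
  assumes f: "convex_on UNIV f" and L: "grad_sup_norm f \<le> ereal L"
  shows "\<bar>f x - f y\<bar> \<le> L * l1_norm (x - y)"
proof -
  have *: "f x - f y \<le> L * l1_norm (x - y)" for x y
  proof -
    obtain g where g: "g \<in> subdifferential f x" using convex_has_subgradient[OF f] by blast
    then have "ereal (infnorm g) \<le> grad_sup_norm f"
      unfolding grad_sup_norm_def by (meson SUP_upper SUP_upper2 UNIV_I)
    with L have gL: "infnorm g \<le> L" by (metis ereal_less_eq(3) order_trans)
    have "f x - f y \<le> g \<bullet> (x - y)"
      using g by (auto simp: subdifferential_def inner_diff_right algebra_simps)
    also have "\<dots> \<le> infnorm g * l1_norm (x - y)" by (rule inner_le_infnorm_l1_norm)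
    also have "\<dots> \<le> L * l1_norm (x - y)" by (intro mult_right_mono gL) (simp add: l1_norm_def sum_nonneg)
    finally show ?thesis .
  qed
  show ?thesis using *[of x y] *[of y x] l1_norm_minus_commute[of x y] by (simp add: abs_le_iff)
qed

lemma subgradient_norm_le:
  fixes f :: "'a::real_inner \<Rightarrow> real"
  assumes "\<And>x y. \<bar>f x - f y\<bar> \<le> L * norm (x - y)" "0 \<le> L" "g \<in> subdifferential f x"
  shows "norm g \<le> L"
proof (cases "g = 0")
  case False
  have "f x + g \<bullet> g \<le> f (x + g)"
    using assms(3) by (auto simp: subdifferential_def dest: spec[of _ "x + g"])
  moreover have "f (x + g) - f x \<le> L * norm g" using assms(1)[of "x+g" x] by simp
  ultimately have "norm g * norm g \<le> L * norm g"
    by (simp add: power2_norm_eq_inner[symmetric] power2_eq_square)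
  then show ?thesis using False by simp
qed (use assms in auto)

lemma borel_measurable_lipschitz:
  fixes f :: "'a::real_normed_vector \<Rightarrow> real"
  assumes "\<And>x y. \<bar>f x - f y\<bar> \<le> L * norm (x - y)"
  shows "f \<in> borel_measurable borel"
proof -
  have L: "\<bar>f x - f y\<bar> \<le> (\<bar>L\<bar> + 1) * norm (x - y)" for x y
  proof -
    have "L * norm (x - y) \<le> (\<bar>L\<bar> + 1) * norm (x - y)" by (intro mult_right_mono) auto
    then show ?thesis using assms[of x y] by linarith
  qed
  have "continuous_on UNIV f"
    unfolding continuous_on_iff
  proof (intro ballI allI impI)
    fix x :: 'a and e :: real assume "e > 0"
    have "dist (f y) (f x) < e" if "dist y x < e / (\<bar>L\<bar> + 1)" for y
    proof -
      have "(\<bar>L\<bar> + 1) * norm (y - x) < e" using that by (simp add: dist_norm field_simps add_pos_nonneg)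
      with L[of y x] show ?thesis by (simp add: dist_norm)
    qed
    with \<open>e > 0\<close> show "\<exists>d>0. \<forall>x'\<in>UNIV. dist x' x < d \<longrightarrow> dist (f x') (f x) < e"
      by (intro exI[of _ "e / (\<bar>L\<bar> + 1)"]) (auto simp: add_nonneg_pos)
  qed
  then show ?thesis by (rule borel_measurable_continuous_onI)
qed

section \<open>The Moreau envelope of a Lipschitz convex function\<close>

text \<open>On convex functions the envelope loses no information (\<open>moreau_envelope_recovers\<close>), and it is smooth:
its second differences along \<open>v\<close> lie between \<open>0\<close> and \<open>|v|\<^sup>2\<close>.  Hence a fine description of a
nonsmooth convex function is obtained from the values of a smooth function on a coarse grid.\<close>

definition moreau_envelope :: "('a::real_normed_vector \<Rightarrow> real) \<Rightarrow> 'a \<Rightarrow> real" where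
  "moreau_envelope f z = (INF y. f y + (norm (y - z))\<^sup>2 / 2)"

context
  fixes f :: "'a::euclidean_space \<Rightarrow> real"
  assumes lip: "\<And>x y. \<bar>f x - f y\<bar> \<le> norm (x - y)"
begin

lemma moreau_envelope_integrand_ge: "f z - 1 / 2 \<le> f y + (norm (y - z))\<^sup>2 / 2"
proof -
  have "0 \<le> (norm (y - z) - 1)\<^sup>2" by simp
  then have "norm (y - z) - 1 / 2 \<le> (norm (y - z))\<^sup>2 / 2" by (simp add: power2_eq_square algebra_simps)
  then show ?thesis using lip[of y z] by linarith
qed

lemma moreau_envelope_bdd: "bdd_below (range (\<lambda>y. f y + (norm (y - z))\<^sup>2 / 2))"
  using moreau_envelope_integrand_ge by (meson bdd_belowI2)

lemma moreau_envelope_le: "moreau_envelope f z \<le> f y + (norm (y - z))\<^sup>2 / 2"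
  unfolding moreau_envelope_def by (rule cINF_lower[OF moreau_envelope_bdd]) simp

lemma moreau_envelope_greatest:
  "(\<And>y. c \<le> f y + (norm (y - z))\<^sup>2 / 2) \<Longrightarrow> c \<le> moreau_envelope f z"
  unfolding moreau_envelope_def by (rule cINF_greatest) auto

lemma moreau_envelope_near: "\<bar>moreau_envelope f z - f z\<bar> \<le> 1 / 2"
  using moreau_envelope_le[of z z] moreau_envelope_greatest[OF moreau_envelope_integrand_ge, of z] by simp

text \<open>As an infimum of paraboloids with the same curvature the envelope is semiconcave; the same competitor
\<open>y\<close> is used at all three points.\<close>

lemma moreau_envelope_second_difference_le:
  "moreau_envelope f (z + 2 *\<^sub>R v) - 2 * moreau_envelope f (z + v) + moreau_envelope f z \<le> (norm v)\<^sup>2"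
proof -
  have "(moreau_envelope f (z + 2 *\<^sub>R v) + moreau_envelope f z - (norm v)\<^sup>2) / 2 \<le> moreau_envelope f (z + v)"
  proof (rule moreau_envelope_greatest)
    fix y
    have "(norm (y - (z + 2 *\<^sub>R v)))\<^sup>2 + (norm (y - z))\<^sup>2 = 2 * (norm (y - (z + v)))\<^sup>2 + 2 * (norm v)\<^sup>2"
      by (simp add: power2_norm_eq_inner inner_diff inner_add inner_commute algebra_simps)
    with moreau_envelope_le[of "z + 2 *\<^sub>R v" y] moreau_envelope_le[of z y]
    show "(moreau_envelope f (z + 2 *\<^sub>R v) + moreau_envelope f z - (norm v)\<^sup>2) / 2
      \<le> f y + (norm (y - (z + v)))\<^sup>2 / 2" by argo
  qed
  then show ?thesis by simp
qed

context
  assumes conv: "convex_on UNIV f"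
begin

text \<open>Convexity of \<open>f\<close> passes to the envelope: the midpoint of two competitors competes at the midpoint.\<close>

lemma moreau_envelope_second_difference_ge:
  "0 \<le> moreau_envelope f (z + 2 *\<^sub>R v) - 2 * moreau_envelope f (z + v) + moreau_envelope f z"
proof -
  have *: "2 * moreau_envelope f (z + v) \<le> (f y + (norm (y - z))\<^sup>2 / 2) + (f y' + (norm (y' - (z + 2 *\<^sub>R v)))\<^sup>2 / 2)" for y y'
  proof -
    define w where "w = (1/2) *\<^sub>R y + (1/2) *\<^sub>R y'"
    have "f w \<le> (1/2) * f y + (1/2) * f y'"
      unfolding w_def using convex_onD[OF conv, of "1/2" y y'] by simp
    moreover have "w - (z + v) = (1/2) *\<^sub>R ((y - z) + (y' - (z + 2 *\<^sub>R v)))"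
      by (simp add: w_def algebra_simps) (simp flip: scaleR_add_left)
    then have "(norm (w - (z + v)))\<^sup>2 = (norm ((y - z) + (y' - (z + 2 *\<^sub>R v))))\<^sup>2 / 4"
      by (simp add: power2_eq_square)
    moreover have "(norm (p + q))\<^sup>2 \<le> 2 * (norm p)\<^sup>2 + 2 * (norm q)\<^sup>2" for p q :: 'a
    proof -
      have "0 \<le> (norm (p - q))\<^sup>2" by simp
      also have "(norm (p - q))\<^sup>2 = 2 * (norm p)\<^sup>2 + 2 * (norm q)\<^sup>2 - (norm (p + q))\<^sup>2"
        by (simp add: power2_norm_eq_inner inner_diff inner_add inner_commute)
      finally show ?thesis by simp
    qed
    note this[of "y - z" "y' - (z + 2 *\<^sub>R v)"]
    moreover have "moreau_envelope f (z + v) \<le> f w + (norm (w - (z + v)))\<^sup>2 / 2"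
      by (rule moreau_envelope_le)
    ultimately show ?thesis by argo
  qed
  have "2 * moreau_envelope f (z + v) - moreau_envelope f z \<le> moreau_envelope f (z + 2 *\<^sub>R v)"
  proof (rule moreau_envelope_greatest)
    fix y'
    have "2 * moreau_envelope f (z + v) - (f y' + (norm (y' - (z + 2 *\<^sub>R v)))\<^sup>2 / 2) \<le> moreau_envelope f z"
      by (rule moreau_envelope_greatest) (use * in \<open>simp add: algebra_simps\<close>)
    then show "2 * moreau_envelope f (z + v) - moreau_envelope f z \<le> f y' + (norm (y' - (z + 2 *\<^sub>R v)))\<^sup>2 / 2"
      by simp
  qed
  then show ?thesis by simp
qed

text \<open>The function \<open>f\<close> is recovered as the supremum over \<open>z\<close> of the right-hand side.  This supremum is attained
at \<open>z = x + g\<close> and only a quadratic error is made at nearby points, so a supremum over grid points with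
mesh \<open>h\<close> gives \<open>f x\<close> up to order \<open>h\<^sup>2\<close>.\<close>

lemma moreau_envelope_recovers:
  assumes g: "g \<in> subdifferential f x"
  shows "f x - (norm (z - (x + g)))\<^sup>2 / 2 \<le> moreau_envelope f z - (norm (x - z))\<^sup>2 / 2"
proof -
  have "f x - (norm (z - (x + g)))\<^sup>2 / 2 + (norm (x - z))\<^sup>2 / 2 \<le> moreau_envelope f z"
  proof (rule moreau_envelope_greatest)
    fix y
    have "f x + g \<bullet> (y - x) \<le> f y" using g by (simp add: subdifferential_def)
    moreover have "(norm (y - z + g))\<^sup>2 = (norm (y - z))\<^sup>2 + (norm (z - (x + g)))\<^sup>2 - (norm (x - z))\<^sup>2 + 2 * (g \<bullet> (y - x))"
      by (simp add: power2_norm_eq_inner inner_diff inner_add inner_commute algebra_simps)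
    moreover have "0 \<le> (norm (y - z + g))\<^sup>2" by simp
    ultimately show "f x - (norm (z - (x + g)))\<^sup>2 / 2 + (norm (x - z))\<^sup>2 / 2 \<le> f y + (norm (y - z))\<^sup>2 / 2"
      by argo
  qed
  then show ?thesis by simp
qed

end
end

section \<open>Metric entropy of Lipschitz convex functions\<close>

text \<open>Convex functions with Lipschitz constant \<open>l\<close> on the ball of radius \<open>R\<close> are brought into this class by
rescaling the argument by \<open>R\<close> and the values by \<open>l R\<close>.  The bound at the origin fixes the additive
constant; the value \<open>4\<close> leaves room for the estimator, which is only known to be near the regression
function at one sample point.\<close>

definition unit_convex_class :: "(real ^ 'd \<Rightarrow> real) set" where
  "unit_convex_class = {f. convex_on UNIV f \<and> (\<forall>x y. \<bar>f x - f y\<bar> \<le> norm (x - y)) \<and> \<bar>f 0\<bar> \<le> 4}"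

text \<open>The indices between \<open>0\<close> and \<open>4 m\<close> give a grid with mesh \<open>1/m\<close> of the cube \<open>[-2, 2]\<^sup>d\<close>, which contains
\<open>x + g\<close> for every \<open>x\<close> in the unit ball and every subgradient \<open>g\<close> of a function with Lipschitz
constant one.\<close>

definition grid_point :: "nat \<Rightarrow> ('d \<Rightarrow> nat) \<Rightarrow> real ^ 'd" where
  "grid_point m j = (\<chi> i. real (j i) / real m - 2)"

definition rounded_envelope :: "nat \<Rightarrow> (real ^ 'd \<Rightarrow> real) \<Rightarrow> ('d \<Rightarrow> nat) \<Rightarrow> int" where
  "rounded_envelope m f j = \<lfloor>(real m)\<^sup>2 * moreau_envelope f (grid_point m j)\<rfloor>"

text \<open>Second differences of the rounded envelope along one coordinate.  They take only a few values,
whereas the rounded values themselves range over an interval of length of order \<open>m\<^sup>2\<close>; storing the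
values only at the \<open>2\<^sup>d\<close> points where no backward second difference exists avoids a factor \<open>ln m\<close> in the
entropy.  This factor could not be afforded in the rate for large \<open>\<gamma>\<close>.\<close>

definition envelope_code :: "nat \<Rightarrow> (real ^ 'd \<Rightarrow> real) \<Rightarrow> ('d \<Rightarrow> nat) \<Rightarrow> int" where
  "envelope_code m f j =
     (if \<forall>i. j i < 2 then rounded_envelope m f j
      else let i = (SOME i. 2 \<le> j i) in
        rounded_envelope m f j - 2 * rounded_envelope m f (j(i := j i - 1))
          + rounded_envelope m f (j(i := j i - 2)))"

text \<open>The second differences form a recursion which computes each value from two smaller multi-indices.\<close>

lemma envelope_code_determines_rounded_envelope:
  fixes j :: "'d::finite \<Rightarrow> nat"
  assumes "\<And>k. (\<forall>i. k i \<le> N) \<Longrightarrow> envelope_code m f k = envelope_code m h k" "\<forall>i. j i \<le> N"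
  shows "rounded_envelope m f j = rounded_envelope m h j"
  using assms(2)
proof (induction "\<Sum>i\<in>UNIV. j i" arbitrary: j rule: less_induct)
  case less
  show ?case
  proof (cases "\<forall>i. j i < 2")
    case True
    then show ?thesis using assms(1)[OF less.prems] by (simp add: envelope_code_def)
  next
    case False
    define i where "i = (SOME i. 2 \<le> j i)"
    have i: "2 \<le> j i" unfolding i_def by (rule someI_ex) (use False in \<open>simp add: not_less\<close>)
    have "rounded_envelope m f (j(i := j i - r)) = rounded_envelope m h (j(i := j i - r))"
      if "r = 1 \<or> r = 2" for r
    proof (rule less.hyps)
      show "(\<Sum>k\<in>UNIV. (j(i := j i - r)) k) < (\<Sum>k\<in>UNIV. j k)"
        by (rule sum_strict_mono_ex1) (use that i in \<open>auto intro!: bexI[of _ i]\<close>)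
      show "\<forall>k. (j(i := j i - r)) k \<le> N"
        using less.prems by (auto intro: order_trans[OF diff_le_self])
    qed
    then show ?thesis
      using assms(1)[OF less.prems] False
      by (simp add: envelope_code_def Let_def i_def[symmetric])
  qed
qed

lemma norm_grid_point_le:
  fixes j :: "'d::finite \<Rightarrow> nat"
  assumes "m \<ge> 1" "\<And>i. j i \<le> 4 * m"
  shows "norm (grid_point m j) \<le> 2 * real CARD('d)"
proof -
  have "norm (grid_point m j) \<le> (\<Sum>i\<in>UNIV. \<bar>grid_point m j $ i\<bar>)" by (rule norm_le_l1_cart)
  also have "\<dots> \<le> (\<Sum>i\<in>(UNIV::'d set). 2)"
  proof (rule sum_mono)
    fix i
    have "real (j i) \<le> 4 * real m" using assms(2)[of i] by linarith
    then show "\<bar>grid_point m j $ i\<bar> \<le> 2" using assms(1)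
      by (simp add: grid_point_def abs_le_iff field_simps)
  qed
  finally show ?thesis by simp
qed

text \<open>Before rounding, the second difference multiplied by \<open>m\<^sup>2\<close> lies in \<open>[0, 1]\<close>; rounding three values, one of them
with weight two, moves it by at most two.\<close>

lemma envelope_code_interior:
  fixes f :: "real ^ 'd \<Rightarrow> real"
  assumes f: "f \<in> unit_convex_class" and m: "m \<ge> 1" and j: "\<not> (\<forall>i. j i < 2)"
  shows "envelope_code m f j \<in> {-3..3}"
proof -
  define i where "i = (SOME i. 2 \<le> j i)"
  have i: "2 \<le> j i" unfolding i_def by (rule someI_ex) (use j in \<open>simp add: not_less\<close>)
  define z where "z = grid_point m (j(i := j i - 2))"
  define v :: "real ^ 'd" where "v = (1 / real m) *\<^sub>R axis i 1"
  have z1: "grid_point m (j(i := j i - 1)) = z + v" and z2: "grid_point m j = z + 2 *\<^sub>R v"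
    using i m by (auto simp: vec_eq_iff z_def v_def grid_point_def axis_def of_nat_diff field_simps)
  have lip: "\<And>x y. \<bar>f x - f y\<bar> \<le> norm (x - y)" and conv: "convex_on UNIV f"
    using f by (auto simp: unit_convex_class_def)
  have nv: "(norm v)\<^sup>2 = 1 / (real m)\<^sup>2" by (simp add: v_def norm_axis_1 power_divide)
  define D where "D = moreau_envelope f (z + 2 *\<^sub>R v) - 2 * moreau_envelope f (z + v) + moreau_envelope f z"
  have D: "0 \<le> D" "D \<le> 1 / (real m)\<^sup>2"
    using moreau_envelope_second_difference_ge[OF lip conv, of z v]
      moreau_envelope_second_difference_le[OF lip, of z v] nv by (auto simp: D_def)
  have "0 \<le> (real m)\<^sup>2 * D" using D by simp
  moreover have "(real m)\<^sup>2 * D \<le> 1" using D m by (simp add: field_simps)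
  moreover have "(real m)\<^sup>2 * D = (real m)\<^sup>2 * moreau_envelope f (z + 2 *\<^sub>R v) - 2 * ((real m)\<^sup>2 * moreau_envelope f (z + v)) + (real m)\<^sup>2 * moreau_envelope f z"
    by (simp add: D_def algebra_simps)
  moreover have "envelope_code m f j = \<lfloor>(real m)\<^sup>2 * moreau_envelope f (z + 2 *\<^sub>R v)\<rfloor>
     - 2 * \<lfloor>(real m)\<^sup>2 * moreau_envelope f (z + v)\<rfloor> + \<lfloor>(real m)\<^sup>2 * moreau_envelope f z\<rfloor>"
    using j unfolding envelope_code_def Let_def i_def[symmetric] rounded_envelope_def z1 z2 z_def[symmetric]
    by auto
  ultimately show ?thesis by simp linarith
qed

lemma envelope_code_base:
  fixes f :: "real ^ 'd \<Rightarrow> real"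
  assumes f: "f \<in> unit_convex_class" and m: "m \<ge> 1" and j: "\<And>i. j i \<le> 4 * m" "\<forall>i. j i < 2"
  defines "K \<equiv> int m ^ 2 * (6 + 2 * int CARD('d))"
  shows "envelope_code m f j \<in> {-K..K}"
proof -
  define z where "z = grid_point m j"
  have lip: "\<And>x y. \<bar>f x - f y\<bar> \<le> norm (x - y)" and f0: "\<bar>f 0\<bar> \<le> 4"
    using f by (auto simp: unit_convex_class_def)
  have "norm z \<le> 2 * real CARD('d)" unfolding z_def by (rule norm_grid_point_le[OF m j(1)])
  then have e: "\<bar>moreau_envelope f z\<bar> \<le> 5 + 2 * real CARD('d)"
    using lip[of z 0, unfolded abs_le_iff] f0[unfolded abs_le_iff]
      moreau_envelope_near[OF lip, of z, unfolded abs_le_iff] by (simp add: abs_le_iff)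
  define M where "M = (real m)\<^sup>2"
  have M: "M \<ge> 1" using m by (simp add: M_def)
  have "\<bar>M * moreau_envelope f z\<bar> \<le> M * (5 + 2 * real CARD('d))"
    unfolding abs_mult using e M by (intro mult_mono) auto
  also have "\<dots> \<le> M * (6 + 2 * real CARD('d)) - 1" using M by (simp add: algebra_simps)
  finally have *: "\<bar>M * moreau_envelope f z\<bar> \<le> real_of_int K - 1" by (simp add: K_def M_def)
  have "envelope_code m f j = \<lfloor>M * moreau_envelope f z\<rfloor>"
    using j by (simp add: envelope_code_def rounded_envelope_def z_def M_def)
  then show ?thesis using * by simp linarith
qed

lemma grid_point_near:
  fixes w :: "real ^ 'd"
  assumes m: "m \<ge> 1" and w: "\<And>i. \<bar>w $ i\<bar> \<le> 2"
  shows "\<exists>j. (\<forall>i. j i \<le> 4 * m) \<and> (norm (grid_point m j - w))\<^sup>2 \<le> (real CARD('d) / real m)\<^sup>2"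
proof -
  define j where "j = (\<lambda>i. nat \<lfloor>real m * (w $ i + 2)\<rfloor>)"
  have j: "real (j i) \<le> real m * (w $ i + 2)" "real m * (w $ i + 2) \<le> real (j i) + 1" "j i \<le> 4 * m" for i
  proof -
    have p: "0 \<le> real m * (w $ i + 2)" using w[of i] by simp
    then show "real (j i) \<le> real m * (w $ i + 2)" "real m * (w $ i + 2) \<le> real (j i) + 1"
      unfolding j_def by linarith+
    have "real m * (w $ i + 2) \<le> real m * 4" using w[of i] by (intro mult_left_mono) auto
    with \<open>real (j i) \<le> real m * (w $ i + 2)\<close> have "real (j i) \<le> real (4 * m)" by simp
    then show "j i \<le> 4 * m" by linarith
  qed
  have "norm (grid_point m j - w) \<le> (\<Sum>i\<in>UNIV. \<bar>(grid_point m j - w) $ i\<bar>)" by (rule norm_le_l1_cart)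
  also have "\<dots> \<le> (\<Sum>i\<in>(UNIV::'d set). 1 / real m)"
  proof (rule sum_mono)
    fix i
    show "\<bar>(grid_point m j - w) $ i\<bar> \<le> 1 / real m"
    proof -
      have "real (j i) / real m \<le> w $ i + 2" "w $ i + 2 \<le> (real (j i) + 1) / real m"
        using j(1,2)[of i] m by (simp_all add: field_simps)
      then show ?thesis by (simp add: grid_point_def abs_le_iff add_divide_distrib)
    qed
  qed
  finally have "norm (grid_point m j - w) \<le> real CARD('d) / real m" by simp
  then show ?thesis using j(3) by (intro exI[of _ j]) (auto intro!: power_mono)
qed

text \<open>Take a grid point \<open>z\<close> close to \<open>x + g\<close> for a subgradient \<open>g\<close> of \<open>f\<close> at \<open>x\<close>.  Up to an error quadratic in the mesh,
the envelope of \<open>f\<close> at \<open>z\<close> bounds \<open>f x\<close> from above; the envelope of \<open>h\<close> at \<open>z\<close> bounds \<open>h x\<close> from below; and the two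
envelopes differ at \<open>z\<close> by at most one unit of rounding.\<close>

lemma envelope_code_separates:
  fixes f h :: "real ^ 'd \<Rightarrow> real"
  assumes f: "f \<in> unit_convex_class" and h: "h \<in> unit_convex_class" and m: "m \<ge> 1"
    and code: "\<And>k. (\<forall>i. k i \<le> 4 * m) \<Longrightarrow> envelope_code m f k = envelope_code m h k"
    and x: "norm x \<le> 1"
  shows "f x - h x \<le> (1 + (real CARD('d))\<^sup>2) / (real m)\<^sup>2"
proof -
  have lip: "\<And>x y. \<bar>f x - f y\<bar> \<le> norm (x - y)" and conv: "convex_on UNIV f"
    and liph: "\<And>x y. \<bar>h x - h y\<bar> \<le> norm (x - y)"
    using f h by (auto simp: unit_convex_class_def)
  obtain g where g: "g \<in> subdifferential f x" using convex_has_subgradient[OF conv] by blast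
  have "norm g \<le> 1" using subgradient_norm_le[OF _ _ g, of 1] lip by simp
  then have "\<bar>(x + g) $ i\<bar> \<le> 2" for i
    using x component_le_norm_cart[of "x + g" i] norm_triangle_ineq[of x g] by linarith
  then obtain j where j: "\<forall>i. j i \<le> 4 * m"
    "(norm (grid_point m j - (x + g)))\<^sup>2 \<le> (real CARD('d) / real m)\<^sup>2"
    using grid_point_near[OF m] by blast
  define z where "z = grid_point m j"
  have "rounded_envelope m f j = rounded_envelope m h j"
    using envelope_code_determines_rounded_envelope[OF code j(1)] .
  then have "(real m)\<^sup>2 * moreau_envelope f z \<le> (real m)\<^sup>2 * moreau_envelope h z + 1"
    unfolding rounded_envelope_def z_def by linarith
  then have "(real m)\<^sup>2 * (moreau_envelope f z - moreau_envelope h z) \<le> 1" by (simp add: algebra_simps)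
  then have "moreau_envelope f z - moreau_envelope h z \<le> 1 / (real m)\<^sup>2"
    using m by (simp add: field_simps)
  moreover have "f x - (norm (z - (x + g)))\<^sup>2 / 2 \<le> moreau_envelope f z - (norm (x - z))\<^sup>2 / 2"
    by (rule moreau_envelope_recovers[OF lip conv g])
  moreover have "moreau_envelope h z \<le> h x + (norm (x - z))\<^sup>2 / 2"
    by (rule moreau_envelope_le[OF liph])
  moreover have "(norm (z - (x + g)))\<^sup>2 \<le> (real CARD('d))\<^sup>2 / (real m)\<^sup>2" using j(2) by (simp add: z_def power_divide)
  moreover have "0 \<le> (real CARD('d))\<^sup>2 / (real m)\<^sup>2" by simp
  moreover have "(1 + (real CARD('d))\<^sup>2) / (real m)\<^sup>2 = 1 / (real m)\<^sup>2 + (real CARD('d))\<^sup>2 / (real m)\<^sup>2"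
    by (simp add: add_divide_distrib)
  ultimately show ?thesis by argo
qed

text \<open>The \<open>(4 m + 1)\<^sup>d\<close> second differences contribute a factor \<open>7\<close> each, and the \<open>2\<^sup>d\<close> stored values contribute a
power of \<open>m\<close>, whose logarithm is negligible against \<open>m\<^sup>d\<close>.\<close>

lemma card_envelope_codes_le:
  fixes m :: nat
  assumes m: "m \<ge> 1"
  defines "d \<equiv> CARD('d::finite)"
  defines "J \<equiv> {j :: 'd \<Rightarrow> nat. \<forall>i. j i \<le> 4 * m}"
  defines "K \<equiv> int m ^ 2 * (6 + 2 * int d)"
  defines "codes \<equiv> PiE J (\<lambda>j. if \<forall>i. j i < 2 then {-K..K} else {-3..3})"
  shows "finite codes"
    and "real (card codes) \<le> exp ((2 ^ d * (ln (13 + 4 * real d) + 2) + 3 * 5 ^ d) * real m ^ d)"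
proof -
  have J: "J = PiE UNIV (\<lambda>_. {..4 * m})" by (auto simp: J_def PiE_def Pi_def)
  then have finJ: "finite J" by (simp add: finite_PiE)
  have cardJ: "card J = (4 * m + 1) ^ d" unfolding J by (subst card_PiE) (auto simp: d_def)
  show "finite codes" unfolding codes_def using finJ by (intro finite_PiE) auto
  define b where "b = {j :: 'd \<Rightarrow> nat. \<forall>i. j i < 2}"
  have "b = PiE UNIV (\<lambda>_. {..<2})" by (auto simp: b_def PiE_def Pi_def)
  then have finb: "finite b" and cardb: "card b = 2 ^ d"
    by (simp_all add: finite_PiE card_PiE d_def)
  have K0: "K \<ge> 0" by (simp add: K_def)
  have "card codes = (\<Prod>j\<in>J. if j \<in> b then nat (2 * K + 1) else 7)"
    unfolding codes_def by (subst card_PiE[OF finJ]) (auto simp: b_def intro!: prod.cong)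
  also have "\<dots> = nat (2 * K + 1) ^ card (J \<inter> b) * 7 ^ card (J \<inter> - b)"
    by (subst prod.If_cases[OF finJ]) simp
  finally have "real (card codes) = (real (nat (2 * K + 1))) ^ card (J \<inter> b) * 7 ^ card (J \<inter> - b)" by simp
  also have "\<dots> \<le> (real (nat (2 * K + 1))) ^ (2 ^ d) * 7 ^ ((4 * m + 1) ^ d)"
  proof (intro mult_mono power_increasing)
    show "card (J \<inter> b) \<le> 2 ^ d" unfolding cardb[symmetric] using finb by (intro card_mono) auto
    show "card (J \<inter> - b) \<le> (4 * m + 1) ^ d" unfolding cardJ[symmetric] using finJ by (intro card_mono) auto
  qed (use K0 in auto)
  also have "\<dots> \<le> exp (2 ^ d * (ln (13 + 4 * real d) + 2) * real m ^ d) * exp (3 * 5 ^ d * real m ^ d)"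
  proof (intro mult_mono)
    have md: "real m \<le> real m ^ d" and m1: "1 \<le> real m ^ d"
      using m by (auto simp: d_def intro!: self_le_power)
    have "real (nat (2 * K + 1)) = 2 * ((real m)\<^sup>2 * (6 + 2 * real d)) + 1"
      using K0 by (simp add: K_def)
    also have "\<dots> \<le> (real m)\<^sup>2 * (13 + 4 * real d)" using m by (simp add: algebra_simps)
    finally have K: "real (nat (2 * K + 1)) \<le> (real m)\<^sup>2 * (13 + 4 * real d)" .
    have "ln ((real m)\<^sup>2 * (13 + 4 * real d)) = 2 * ln (real m) + ln (13 + 4 * real d)"
      using m by (subst ln_mult) (auto simp: ln_realpow add_pos_nonneg)
    also have "\<dots> \<le> 2 * real m ^ d + ln (13 + 4 * real d) * real m ^ d"
    proof (intro add_mono)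
      show "2 * ln (real m) \<le> 2 * real m ^ d" proof -
        have "ln (real m) \<le> real m - 1" by (rule ln_le_minus_one) (use m in simp)
        then show ?thesis using md by linarith
      qed
      show "ln (13 + 4 * real d) \<le> ln (13 + 4 * real d) * real m ^ d"
        using m1 by (simp add: mult_le_cancel_left1)
    qed
    finally have "ln ((real m)\<^sup>2 * (13 + 4 * real d)) \<le> (ln (13 + 4 * real d) + 2) * real m ^ d"
      by (simp add: algebra_simps)
    moreover have pos: "0 < (real m)\<^sup>2 * (13 + 4 * real d)" using m by (intro mult_pos_pos) auto
    ultimately have "(real m)\<^sup>2 * (13 + 4 * real d) \<le> exp ((ln (13 + 4 * real d) + 2) * real m ^ d)"
      by (metis exp_le_cancel_iff exp_ln)
    with K have "real (nat (2 * K + 1)) ^ (2 ^ d) \<le> exp ((ln (13 + 4 * real d) + 2) * real m ^ d) ^ (2 ^ d)"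
      by (intro power_mono) auto
    also have "\<dots> = exp (2 ^ d * (ln (13 + 4 * real d) + 2) * real m ^ d)"
      by (simp add: exp_of_nat_mult[symmetric] mult.assoc)
    finally show "real (nat (2 * K + 1)) ^ (2 ^ d) \<le> exp (2 ^ d * (ln (13 + 4 * real d) + 2) * real m ^ d)" .
    have "(2::real) ^ 3 \<le> exp 1 ^ 3" using exp_ge_add_one_self[of 1] by (intro power_mono) auto
    then have "7 \<le> exp (3::real)" by (simp add: exp_of_nat_mult[symmetric])
    then have "(7::real) ^ ((4 * m + 1) ^ d) \<le> exp 3 ^ ((4 * m + 1) ^ d)" by (intro power_mono) auto
    also have "\<dots> = exp (3 * (4 * real m + 1) ^ d)" by (simp add: exp_of_nat_mult[symmetric] mult.commute add.commute)
    also have "\<dots> \<le> exp (3 * (5 * real m) ^ d)" using m by (intro iffD2[OF exp_le_cancel_iff] mult_left_mono power_mono) auto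
    finally show "(7::real) ^ ((4 * m + 1) ^ d) \<le> exp (3 * 5 ^ d * real m ^ d)" by (simp add: power_mult_distrib mult.assoc)
  qed auto
  also have "\<dots> = exp ((2 ^ d * (ln (13 + 4 * real d) + 2) + 3 * 5 ^ d) * real m ^ d)"
    by (simp add: exp_add[symmetric] algebra_simps)
  finally show "real (card codes) \<le> exp ((2 ^ d * (ln (13 + 4 * real d) + 2) + 3 * 5 ^ d) * real m ^ d)" .
qed

text \<open>Bronshtein's entropy bound: at resolution \<open>\<epsilon> = 1/m\<^sup>2\<close> the logarithm of the covering number has order
\<open>\<epsilon>^(- d/2)\<close>, without a logarithmic factor.  One representative is chosen for every
code.\<close>

lemma unit_convex_class_covering:
  "\<exists>C\<ge>1. \<forall>m\<ge>1. \<exists>N \<subseteq> (unit_convex_class :: (real ^ 'd \<Rightarrow> real) set). finite N \<and>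
     real (card N) \<le> exp (C * real m ^ CARD('d)) \<and>
     (\<forall>f\<in>unit_convex_class. \<exists>h\<in>N. \<forall>x. norm x \<le> 1 \<longrightarrow> \<bar>f x - h x\<bar> \<le> C / (real m)\<^sup>2)"
proof -
  define d where "d = CARD('d)"
  \<comment> \<open>Exponent of the number of codes; the other bound in \<open>C\<close> is the distance of functions with the same code.\<close>
  define C1 where "C1 = 2 ^ d * (ln (13 + 4 * real d) + 2) + 3 * 5 ^ d"
  define C where "C = max C1 (1 + (real d)\<^sup>2)"
  show ?thesis
  proof (intro exI[of _ C] conjI allI impI)
    show "C \<ge> 1" by (simp add: C_def le_max_iff_disj)
    fix m :: nat assume m: "m \<ge> 1"
    define J where "J = {j :: 'd \<Rightarrow> nat. \<forall>i. j i \<le> 4 * m}"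
    define K where "K = int m ^ 2 * (6 + 2 * int d)"
    define codes where "codes = PiE J (\<lambda>j. if \<forall>i. j i < 2 then {-K..K} else {-3..3})"
    define code where "code f = restrict (envelope_code m f) J" for f :: "real ^ 'd \<Rightarrow> real"
    define G where "G = (unit_convex_class :: (real ^ 'd \<Rightarrow> real) set)"
    have "code ` G \<subseteq> codes"
    proof (intro image_subsetI)
      fix f assume f: "f \<in> G"
      have "envelope_code m f j \<in> (if \<forall>i. j i < 2 then {-K..K} else {-3..3})" if "j \<in> J" for j
        using envelope_code_base[of f m j] envelope_code_interior[of f m j] f m that
        unfolding G_def J_def K_def d_def by (cases "\<forall>i. j i < 2") auto
      then show "code f \<in> codes" by (auto simp: code_def codes_def)
    qed
    moreover have codes: "finite codes" "real (card codes) \<le> exp (C1 * real m ^ d)"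
      using card_envelope_codes_le[OF m, where 'd='d] unfolding codes_def J_def K_def d_def C1_def by auto
    ultimately have fin: "finite (code ` G)" and card: "card (code ` G) \<le> card codes"
      by (auto intro: finite_subset card_mono)
    define rep where "rep c = (SOME f. f \<in> G \<and> code f = c)" for c
    have rep: "rep c \<in> G \<and> code (rep c) = c" if "c \<in> code ` G" for c
      unfolding rep_def using someI_ex[of "\<lambda>f. f \<in> G \<and> code f = c"] that by blast
    define N where "N = rep ` code ` G"
    show "\<exists>N \<subseteq> unit_convex_class. finite N \<and> real (card N) \<le> exp (C * real m ^ CARD('d)) \<and>
     (\<forall>f\<in>unit_convex_class. \<exists>h\<in>N. \<forall>x. norm x \<le> 1 \<longrightarrow> \<bar>f x - h (x :: real ^ 'd)\<bar> \<le> C / (real m)\<^sup>2)"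
    proof (intro exI[of _ N] conjI ballI)
      show "N \<subseteq> unit_convex_class" using rep by (auto simp: N_def G_def)
      show "finite N" using fin by (simp add: N_def)
      have "card N \<le> card codes" unfolding N_def using card_image_le[OF fin, of rep] card by simp
      then have "real (card N) \<le> exp (C1 * real m ^ d)" using codes(2) by linarith
      also have "\<dots> \<le> exp (C * real m ^ CARD('d))" by (simp add: C_def d_def mult_right_mono)
      finally show "real (card N) \<le> exp (C * real m ^ CARD('d))" .
      fix f :: "real ^ 'd \<Rightarrow> real" assume f: "f \<in> unit_convex_class"
      define h where "h = rep (code f)"
      have h: "h \<in> unit_convex_class" "code h = code f" using rep[of "code f"] f by (auto simp: G_def h_def)
      have eq: "envelope_code m f k = envelope_code m h k" if "\<forall>i. k i \<le> 4 * m" for k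
        using fun_cong[OF h(2), of k] that by (simp add: code_def J_def)
      have "(1 + (real d)\<^sup>2) / (real m)\<^sup>2 \<le> C / (real m)\<^sup>2" by (intro divide_right_mono) (auto simp: C_def)
      then have "\<bar>f x - h x\<bar> \<le> C / (real m)\<^sup>2" if "norm x \<le> 1" for x
        using envelope_code_separates[OF f h(1) m eq that] envelope_code_separates[OF h(1) f m eq[symmetric] that]
        by (simp add: abs_le_iff d_def)
      then show "\<exists>h\<in>N. \<forall>x. norm x \<le> 1 \<longrightarrow> \<bar>f x - h x\<bar> \<le> C / (real m)\<^sup>2"
        using f by (intro bexI[of _ h]) (auto simp: N_def G_def h_def)
    qed
  qed
qed

section \<open>Chaining over the class of convex functions\<close>

text \<open>The two properties of a normalised sum of \<open>n\<close> independent centred terms that chaining uses: the tail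
bound of Hoeffding for increments, and a deterministic Lipschitz bound that takes over below the
finest net.  Distances between functions are measured on the unit ball only.\<close>

definition subgaussian_process ::
    "'w measure \<Rightarrow> nat \<Rightarrow> ((real ^ 'd \<Rightarrow> real) \<Rightarrow> 'w \<Rightarrow> real) \<Rightarrow> bool" where
  "subgaussian_process M n V \<longleftrightarrow>
     (\<forall>g\<in>unit_convex_class. V g \<in> borel_measurable M) \<and>
     (\<forall>g\<in>unit_convex_class. \<forall>h\<in>unit_convex_class. \<forall>\<rho>>0.
        (\<forall>x. norm x \<le> 1 \<longrightarrow> \<bar>g x - h x\<bar> \<le> \<rho>) \<longrightarrow>
        (\<forall>\<omega>\<in>space M. \<bar>V g \<omega> - V h \<omega>\<bar> \<le> 2 * \<rho>) \<and>
        (\<forall>u\<ge>0. measure M {\<omega>\<in>space M. u \<le> \<bar>V g \<omega> - V h \<omega>\<bar>}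
           \<le> 2 * exp (- (real n * u\<^sup>2 / (8 * \<rho>\<^sup>2)))))"

lemma sum_chain_weights_le: "(\<Sum>s<S. (4/5::real) ^ (S - s)) \<le> 4"
proof (induction S)
  case (Suc S)
  have "(\<Sum>s<Suc S. (4/5::real) ^ (Suc S - s)) = (4/5) * (\<Sum>s<S. (4/5) ^ (S - s)) + 4/5"
    by (simp add: sum_distrib_left Suc_diff_le)
  with Suc show ?case by simp
qed simp

text \<open>The deviation \<open>u\<close> allowed at level \<open>s\<close> is a multiple of the final resolution \<open>4^(- S)\<close>, damped by the weight
\<open>(4/5)^(S - s)\<close> so that the deviations have a bounded sum in units of this resolution.  With \<open>j = S - s\<close> the Hoeffding
exponent is then at least a multiple of \<open>2^(S d) / 25^j\<close>, whereas the entropy has order \<open>2^(S d) / 2^(j d)\<close>.  For \<open>d \<ge> 5\<close>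
the former wins because \<open>2^d \<ge> 32 > 25\<close>; for \<open>d = 4\<close> the ratio \<open>4/5\<close> of the weights would have to be \<open>1\<close>.\<close>

lemma chaining_exponent:
  fixes C :: real
  assumes C: "C > 0" and d: "d \<ge> 5" and s: "s < S" and n: "2 ^ (S * d) \<le> real n"
  defines "D \<equiv> 2 * C * 2 ^ d + 1"
  defines "u \<equiv> sqrt (32 * C\<^sup>2 * D) * (4/5) ^ (S - s) / 4 ^ S" and "\<rho> \<equiv> 2 * C / 4 ^ s"
  shows "2 * C * (2 ^ Suc s) ^ d - real n * u\<^sup>2 / (8 * \<rho>\<^sup>2) \<le> - ((32/25) ^ S)"
proof -
  define j where "j = S - s"
  have S: "S = s + j" and j: "j \<le> S" using s by (auto simp: j_def)
  have D: "D > 0" unfolding D_def using C by (intro add_nonneg_pos mult_nonneg_nonneg) auto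
  have p25: "25 ^ j \<le> (2::real) ^ (j * d)"
  proof -
    have "(25::real) ^ j \<le> (2 ^ d) ^ j"
      using power_increasing[OF d, of "2::real"] by (intro power_mono) auto
    then show ?thesis by (simp add: power_mult[symmetric] mult.commute)
  qed
  have "u\<^sup>2 = 32 * C\<^sup>2 * D * ((4/5) ^ j)\<^sup>2 / (4 ^ S)\<^sup>2"
    using D by (simp add: u_def power_mult_distrib power_divide j_def)
  moreover have "\<rho>\<^sup>2 = 4 * C\<^sup>2 / (4 ^ s)\<^sup>2" by (simp add: \<rho>_def power_mult_distrib power_divide)
  ultimately have "u\<^sup>2 / (8 * \<rho>\<^sup>2) = D * (((4/5) ^ j)\<^sup>2 / (4 ^ j)\<^sup>2)"
  proof -
    have "(32 * C\<^sup>2 * D * p\<^sup>2 / (q * r)\<^sup>2) / (8 * (4 * C\<^sup>2 / q\<^sup>2)) = D * (p\<^sup>2 / r\<^sup>2)"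
      if "q \<noteq> 0" "r \<noteq> 0" for p q r :: real
      using C that by (simp add: power_mult_distrib)
    from this[of "4 ^ s" "4 ^ j" "(4/5) ^ j"]
    show "?thesis" if "u\<^sup>2 = 32 * C\<^sup>2 * D * ((4/5) ^ j)\<^sup>2 / (4 ^ S)\<^sup>2" "\<rho>\<^sup>2 = 4 * C\<^sup>2 / (4 ^ s)\<^sup>2"
      unfolding that by (simp add: S power_add)
  qed
  also have "((4/5) ^ j)\<^sup>2 / (4 ^ j)\<^sup>2 = 1 / (25::real) ^ j"
  proof -
    have "(25::real) ^ j = 5 ^ j * 5 ^ j" by (simp flip: power_mult_distrib)
    then show ?thesis by (simp add: power2_eq_square power_divide)
  qed
  finally have "u\<^sup>2 / (8 * \<rho>\<^sup>2) = D * (1 / 25 ^ j)" .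
  then have "real n * (u\<^sup>2 / (8 * \<rho>\<^sup>2)) = real n * (D * (1 / 25 ^ j))" by (rule arg_cong)
  then have "real n * u\<^sup>2 / (8 * \<rho>\<^sup>2) = real n * D / 25 ^ j" by simp
  moreover have "2 ^ (S * d) * D / 25 ^ j \<le> real n * D / 25 ^ j"
    using n D by (intro divide_right_mono mult_right_mono) auto
  moreover have "2 * C * (2 ^ Suc s) ^ d \<le> 2 * C * 2 ^ d * (2 ^ (S * d) / 25 ^ j)"
  proof -
    have "(2::real) ^ (s * d) * 25 ^ j \<le> 2 ^ (s * d) * 2 ^ (j * d)" using p25 by (intro mult_left_mono) auto
    then have "(2::real) ^ (s * d) \<le> 2 ^ (S * d) / 25 ^ j" by (simp add: S field_simps add_mult_distrib power_add)
    then have "2 * C * 2 ^ d * 2 ^ (s * d) \<le> 2 * C * 2 ^ d * (2 ^ (S * d) / 25 ^ j)"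
      using C by (intro mult_left_mono) auto
    moreover have "((2::real) ^ Suc s) ^ d = 2 ^ d * 2 ^ (s * d)"
      by (simp add: power_mult_distrib power_mult)
    ultimately show ?thesis by (simp add: mult.assoc)
  qed
  moreover have "2 ^ (S * d) * D / 25 ^ j = 2 * C * 2 ^ d * (2 ^ (S * d) / 25 ^ j) + 2 ^ (S * d) / 25 ^ j"
    by (simp add: D_def field_simps)
  moreover have "(32/25) ^ S \<le> (2::real) ^ (S * d) / 25 ^ j"
  proof -
    have "(32::real) ^ S \<le> (2 ^ d) ^ S"
      using power_increasing[OF d, of "2::real"] by (intro power_mono) auto
    then have "(32::real) ^ S / 25 ^ S \<le> 2 ^ (S * d) / 25 ^ j"
      using j by (intro frac_le power_increasing) (auto simp: power_mult[symmetric] mult.commute)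
    then show ?thesis by (simp add: power_divide)
  qed
  ultimately show ?thesis by linarith
qed

lemma unit_convex_class_diff_le:
  assumes "g \<in> unit_convex_class" "h \<in> unit_convex_class" "norm x \<le> 1"
  shows "\<bar>g x - h x\<bar> \<le> 10"
proof -
  have "\<bar>g x - g 0\<bar> \<le> norm (x - 0)" "\<bar>h x - h 0\<bar> \<le> norm (x - 0)" "\<bar>g 0\<bar> \<le> 4" "\<bar>h 0\<bar> \<le> 4"
    using assms(1,2) unfolding unit_convex_class_def by blast+
  with assms(3) show ?thesis by simp
qed

text \<open>The net at level \<open>0\<close> consists of the reference function \<open>g0\<close> alone, so that chains starting there measure
the deviation from \<open>g0\<close>.\<close>

definition net_sequence :: "real \<Rightarrow> (real ^ 'd \<Rightarrow> real) \<Rightarrow> (nat \<Rightarrow> (real ^ 'd \<Rightarrow> real) set) \<Rightarrow> bool" where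
  "net_sequence C g0 N \<longleftrightarrow> N 0 = {g0} \<and> (\<forall>s. N s \<subseteq> unit_convex_class \<and>
     finite (N s) \<and> real (card (N s)) \<le> exp (C * (2 ^ s) ^ CARD('d)) \<and>
     (\<forall>g\<in>unit_convex_class. \<exists>h\<in>N s. \<forall>x. norm x \<le> 1 \<longrightarrow> \<bar>g x - h x\<bar> \<le> C / 4 ^ s))"

lemma unit_convex_class_nets:
  "\<exists>C>0. \<forall>g0\<in>(unit_convex_class :: (real ^ 'd \<Rightarrow> real) set). \<exists>N. net_sequence C g0 N"
proof -
  obtain C where C: "C \<ge> 1" and cov: "\<And>m. m \<ge> 1 \<Longrightarrow> \<exists>N \<subseteq> (unit_convex_class :: (real ^ 'd \<Rightarrow> real) set). finite N \<and>
     real (card N) \<le> exp (C * real m ^ CARD('d)) \<and>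
     (\<forall>f\<in>unit_convex_class. \<exists>h\<in>N. \<forall>x. norm x \<le> 1 \<longrightarrow> \<bar>f x - h x\<bar> \<le> C / (real m)\<^sup>2)"
    using unit_convex_class_covering[where 'd='d] by blast
  \<comment> \<open>Two functions of the class differ by at most \<open>10\<close> on the unit ball, so \<open>{g0}\<close> is a net at level \<open>0\<close>.\<close>
  define C' where "C' = max C 10"
  have CC': "C \<le> C'" "10 \<le> C'" by (auto simp: C'_def)
  show ?thesis
  proof (intro exI[of _ C'] conjI ballI)
    show "C' > 0" using CC' by simp
    fix g0 :: "real ^ 'd \<Rightarrow> real" assume g0: "g0 \<in> unit_convex_class"
    have "\<forall>s::nat. \<exists>N. (s = 0 \<longrightarrow> N = {g0}) \<and> N \<subseteq> unit_convex_class \<and>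
     finite N \<and> real (card N) \<le> exp (C' * (2 ^ s) ^ CARD('d)) \<and>
     (\<forall>g\<in>unit_convex_class. \<exists>h\<in>N. \<forall>x. norm x \<le> 1 \<longrightarrow> \<bar>g x - h x\<bar> \<le> C' / 4 ^ s)"
    proof (intro allI, goal_cases)
      case (1 s)
      show ?case
      proof (cases "s = 0")
        case True
        then show ?thesis using g0 CC' unit_convex_class_diff_le[OF _ g0]
          by (intro exI[of _ "{g0}"]) (auto intro: order_trans)
      next
        case False
        obtain N where N: "N \<subseteq> (unit_convex_class :: (real ^ 'd \<Rightarrow> real) set)" "finite N"
          "real (card N) \<le> exp (C * real (2 ^ s) ^ CARD('d))"
          "\<And>f. f\<in>unit_convex_class \<Longrightarrow> \<exists>h\<in>N. \<forall>x. norm x \<le> 1 \<longrightarrow> \<bar>f x - h x\<bar> \<le> C / (real (2 ^ s))\<^sup>2"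
          using cov[of "2 ^ s"] by auto
        have "exp (C * real (2 ^ s) ^ CARD('d)) \<le> exp (C' * (2 ^ s) ^ CARD('d))"
          using CC' by (simp add: mult_right_mono)
        moreover have "C / (real (2 ^ s))\<^sup>2 \<le> C' / 4 ^ s"
        proof -
          have "(real (2 ^ s))\<^sup>2 = 4 ^ s" by (simp add: power2_eq_square flip: power_mult_distrib)
          then show ?thesis using CC' by (simp add: divide_right_mono)
        qed
        ultimately show ?thesis
        proof (intro exI[of _ N] conjI ballI)
          fix g :: "real ^ 'd \<Rightarrow> real" assume "g \<in> unit_convex_class"
          then obtain h where h: "h \<in> N" "\<And>x. norm x \<le> 1 \<Longrightarrow> \<bar>g x - h x\<bar> \<le> C / (real (2 ^ s))\<^sup>2"
            using N(4) by blast
          have "\<bar>g x - h x\<bar> \<le> C' / 4 ^ s" if "norm x \<le> 1" for x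
            using h(2)[OF that] \<open>C / (real (2 ^ s))\<^sup>2 \<le> C' / 4 ^ s\<close> by (rule order_trans)
          then show "\<exists>h\<in>N. \<forall>x. norm x \<le> 1 \<longrightarrow> \<bar>g x - h x\<bar> \<le> C' / 4 ^ s" using h(1) by blast
        next
          show "real (card N) \<le> exp (C' * (2 ^ s) ^ CARD('d))"
            using N(3) \<open>exp (C * real (2 ^ s) ^ CARD('d)) \<le> _\<close> by (rule order_trans)
        qed (use N(1-3) False in auto)
      qed
    qed
    from choice[OF this] obtain N where N: "\<forall>s. (s = 0 \<longrightarrow> N s = {g0}) \<and> N s \<subseteq> unit_convex_class \<and>
     finite (N s) \<and> real (card (N s)) \<le> exp (C' * (2 ^ s) ^ CARD('d)) \<and>
     (\<forall>g\<in>unit_convex_class. \<exists>h\<in>N s. \<forall>x. norm x \<le> 1 \<longrightarrow> \<bar>g x - h (x :: real ^ 'd)\<bar> \<le> C' / 4 ^ s)" ..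
    have "N 0 = {g0}" using N[THEN spec, of 0] by simp
    have "net_sequence C' g0 N"
      unfolding net_sequence_def by (rule conjI, fact, rule allI, rule N[THEN spec, THEN conjunct2])
    then show "\<exists>N. net_sequence C' g0 N" by (rule exI[of _ N])
  qed
qed

text \<open>Every \<open>g\<close> is joined to \<open>g0\<close> by its approximations in the nets of levels \<open>0, ..., S\<close>.  Outside the finite union
\<open>E\<close> of the events that some link is too long, the links add up to a multiple of the finest resolution, and
the rest of the way is covered by the Lipschitz bound.  Since only finitely many links occur,
the supremum over the uncountable class raises no measurability question.\<close>

lemma chaining:
  assumes d: "CARD('d) \<ge> 5"
  shows "\<exists>C>0. \<forall>(M :: 'w measure) n S V (g0 :: real ^ 'd \<Rightarrow> real).
    prob_space M \<longrightarrow> subgaussian_process M n V \<longrightarrow> g0 \<in> unit_convex_class \<longrightarrow> 2 ^ (S * CARD('d)) \<le> real n \<longrightarrow>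
    (\<exists>E\<in>sets M. measure M E \<le> 2 * real S * exp (- ((32/25) ^ S)) \<and>
      (\<forall>\<omega>\<in>space M - E. \<forall>g\<in>unit_convex_class. \<bar>V g \<omega> - V g0 \<omega>\<bar> \<le> C / 4 ^ S))"
proof -
  define d where "d = CARD('d)"
  have d5: "d \<ge> 5" using assms by (simp add: d_def)
  obtain C where C: "C > 0" and nets: "\<forall>g0\<in>(unit_convex_class :: (real ^ 'd \<Rightarrow> real) set). \<exists>N. net_sequence C g0 N"
    using unit_convex_class_nets[where 'd='d] by auto
  define A where "A = sqrt (32 * C\<^sup>2 * (2 * C * 2 ^ d + 1))"
  have A: "A \<ge> 0" using C by (simp add: A_def)
  show ?thesis
  proof (intro exI[of _ "4 * A + 2 * C"] conjI allI impI)
    show "4 * A + 2 * C > 0" using A C by linarith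
    fix M :: "'w measure" and n S :: nat and V :: "(real ^ 'd \<Rightarrow> real) \<Rightarrow> 'w \<Rightarrow> real" and g0 :: "real ^ 'd \<Rightarrow> real"
    assume M: "prob_space M" and V: "subgaussian_process M n V" and g0: "g0 \<in> unit_convex_class"
      and n: "2 ^ (S * CARD('d)) \<le> real n"
    interpret prob_space M by fact
    obtain N where "net_sequence C g0 N" using nets g0 by auto
    then have net: "N 0 = {g0} \<and> (\<forall>s. N s \<subseteq> unit_convex_class \<and>
     finite (N s) \<and> real (card (N s)) \<le> exp (C * (2 ^ s) ^ d) \<and>
     (\<forall>g\<in>unit_convex_class. \<exists>h\<in>N s. \<forall>x. norm x \<le> 1 \<longrightarrow> \<bar>g x - h x\<bar> \<le> C / 4 ^ s))"
      unfolding net_sequence_def d_def .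
    note N0 = net[THEN conjunct1]
    note Ns = net[THEN conjunct2, THEN spec]
    note N = Ns[THEN conjunct1] Ns[THEN conjunct2, THEN conjunct1]
      Ns[THEN conjunct2, THEN conjunct2, THEN conjunct1] Ns[THEN conjunct2, THEN conjunct2, THEN conjunct2]
    define \<rho> where "\<rho> s = 2 * C / 4 ^ s" for s :: nat
    define u where "u s = A * (4/5) ^ (S - s) / 4 ^ S" for s
    have \<rho>: "\<rho> s > 0" and u: "u s \<ge> 0" for s using A C by (auto simp: \<rho>_def u_def)
    \<comment> \<open>Links between consecutive levels, and the event that a link is too long.\<close>
    define P where "P s = {p \<in> N s \<times> N (Suc s). \<forall>x. norm x \<le> 1 \<longrightarrow> \<bar>fst p x - snd p x\<bar> \<le> \<rho> s}" for s
    define F where "F s p = {\<omega>\<in>space M. u s \<le> \<bar>V (fst p) \<omega> - V (snd p) \<omega>\<bar>}" for s p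
    define E where "E = (\<Union>s<S. \<Union>p\<in>P s. F s p)"
    have meas: "V g \<in> borel_measurable M" if "g \<in> unit_convex_class" for g
      using V that by (simp add: subgaussian_process_def)
    have lip: "\<bar>V g \<omega> - V h \<omega>\<bar> \<le> 2 * r" if "g \<in> unit_convex_class" "h \<in> unit_convex_class" "r > 0"
      "\<forall>x. norm x \<le> 1 \<longrightarrow> \<bar>g x - h x\<bar> \<le> r" "\<omega> \<in> space M" for g h r \<omega>
      using V[unfolded subgaussian_process_def, THEN conjunct2, THEN bspec, OF that(1), THEN bspec, OF that(2),
          THEN spec, THEN mp, OF that(3), THEN mp, OF that(4)] that(5) by simp
    have tail: "measure M {\<omega>\<in>space M. v \<le> \<bar>V g \<omega> - V h \<omega>\<bar>} \<le> 2 * exp (- (real n * v\<^sup>2 / (8 * r\<^sup>2)))"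
      if "g \<in> unit_convex_class" "h \<in> unit_convex_class" "r > 0"
      "\<forall>x. norm x \<le> 1 \<longrightarrow> \<bar>g x - h x\<bar> \<le> r" "v \<ge> 0" for g h r v
      using V[unfolded subgaussian_process_def, THEN conjunct2, THEN bspec, OF that(1), THEN bspec, OF that(2),
          THEN spec, THEN mp, OF that(3), THEN mp, OF that(4)] that(5) by simp
    have P: "p \<in> P s \<Longrightarrow> fst p \<in> unit_convex_class \<and> snd p \<in> unit_convex_class" for p s
      using N(1) by (fastforce simp: P_def)
    have finP: "finite (P s)" for s unfolding P_def using N(2) by (auto intro: finite_subset)
    have cardP: "real (card (P s)) \<le> exp (2 * C * (2 ^ Suc s) ^ d)" for s
    proof -
      have "card (P s) \<le> card (N s \<times> N (Suc s))" using N(2) by (intro card_mono) (auto simp: P_def)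
      then have "real (card (P s)) \<le> real (card (N s)) * real (card (N (Suc s)))"
        by (metis card_cartesian_product of_nat_le_iff of_nat_mult)
      also have "\<dots> \<le> exp (C * (2 ^ s) ^ d) * exp (C * (2 ^ Suc s) ^ d)"
        by (intro mult_mono N(3)) auto
      also have "\<dots> = exp (C * (2 ^ s) ^ d + C * (2 ^ Suc s) ^ d)" by (simp add: exp_add)
      also have "\<dots> \<le> exp (C * (2 ^ Suc s) ^ d + C * (2 ^ Suc s) ^ d)"
        using C by (intro iffD2[OF exp_le_cancel_iff] add_mono mult_left_mono power_mono) auto
      finally show ?thesis by (simp only: mult_2 distrib_right)
    qed
    have Fm: "F s p \<in> sets M" if "p \<in> P s" for s p
    proof -
      have [measurable]: "V (fst p) \<in> borel_measurable M" "V (snd p) \<in> borel_measurable M"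
        using meas P[OF that] by auto
      show ?thesis unfolding F_def by measurable
    qed
    show "\<exists>E\<in>sets M. measure M E \<le> 2 * real S * exp (- ((32/25) ^ S)) \<and>
      (\<forall>\<omega>\<in>space M - E. \<forall>g\<in>unit_convex_class. \<bar>V g \<omega> - V g0 \<omega>\<bar> \<le> (4 * A + 2 * C) / 4 ^ S)"
    proof (intro bexI[of _ E] conjI ballI)
      show Em: "E \<in> sets M" unfolding E_def using Fm finP by (intro sets.finite_UN) auto
      have level: "measure M (\<Union>p\<in>P s. F s p) \<le> 2 * exp (- ((32/25) ^ S))" if s: "s < S" for s
      proof -
        have "measure M (\<Union>p\<in>P s. F s p) \<le> (\<Sum>p\<in>P s. measure M (F s p))"
          using Fm finP by (intro measure_UNION_le) auto
        also have "\<dots> \<le> (\<Sum>p\<in>P s. 2 * exp (- (real n * (u s)\<^sup>2 / (8 * (\<rho> s)\<^sup>2))))"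
          unfolding F_def using P \<rho> u by (intro sum_mono tail) (auto simp: P_def)
        also have "\<dots> = 2 * (real (card (P s)) * exp (- (real n * (u s)\<^sup>2 / (8 * (\<rho> s)\<^sup>2))))" by simp
        also have "\<dots> \<le> 2 * (exp (2 * C * (2 ^ Suc s) ^ d) * exp (- (real n * (u s)\<^sup>2 / (8 * (\<rho> s)\<^sup>2))))"
          using cardP by (intro mult_left_mono mult_right_mono) auto
        also have "\<dots> = 2 * exp (2 * C * (2 ^ Suc s) ^ d - real n * (u s)\<^sup>2 / (8 * (\<rho> s)\<^sup>2))"
          by (simp add: exp_add[symmetric])
        also have "\<dots> \<le> 2 * exp (- ((32/25) ^ S))"
          using chaining_exponent[OF C d5 s, of n] n unfolding u_def A_def \<rho>_def d_def
          by (intro mult_left_mono) auto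
        finally show ?thesis .
      qed
      have "measure M E \<le> (\<Sum>s<S. measure M (\<Union>p\<in>P s. F s p))"
        unfolding E_def using Fm finP by (intro measure_UNION_le sets.finite_UN) auto
      also have "\<dots> \<le> (\<Sum>s<S. 2 * exp (- ((32/25) ^ S)))" using level by (intro sum_mono) auto
      finally show "measure M E \<le> 2 * real S * exp (- ((32/25) ^ S))" by (simp add: algebra_simps)
      fix \<omega> g assume \<omega>: "\<omega> \<in> space M - E" and g: "g \<in> (unit_convex_class :: (real ^ 'd \<Rightarrow> real) set)"
      obtain \<pi> where \<pi>: "\<And>s. \<pi> s \<in> N s" "\<And>s x. norm x \<le> 1 \<Longrightarrow> \<bar>g x - \<pi> s x\<bar> \<le> C / 4 ^ s"
      proof -
        have "\<forall>s. \<exists>h. h \<in> N s \<and> (\<forall>x. norm x \<le> 1 \<longrightarrow> \<bar>g x - h x\<bar> \<le> C / 4 ^ s)"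
          using N(4) g by blast
        from choice[OF this] show ?thesis using that by blast
      qed
      have \<pi>U: "\<pi> s \<in> unit_convex_class" for s using \<pi>(1) N(1) by blast
      have step: "\<bar>V (\<pi> (Suc s)) \<omega> - V (\<pi> s) \<omega>\<bar> \<le> u s" if "s < S" for s
      proof -
        have "\<bar>\<pi> s x - \<pi> (Suc s) x\<bar> \<le> \<rho> s" if "norm x \<le> 1" for x
        proof -
          have "C / 4 ^ Suc s \<le> C / 4 ^ s" using C by (simp add: field_simps)
          then show ?thesis using \<pi>(2)[OF that, of s] \<pi>(2)[OF that, of "Suc s"] unfolding \<rho>_def by linarith
        qed
        then have "(\<pi> s, \<pi> (Suc s)) \<in> P s" using \<pi>(1) by (auto simp: P_def)
        then have "\<omega> \<notin> F s (\<pi> s, \<pi> (Suc s))" using \<omega> \<open>s < S\<close> by (auto simp: E_def)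
        then show ?thesis using \<omega> by (auto simp: F_def)
      qed
      have "\<bar>V (\<pi> S) \<omega> - V (\<pi> 0) \<omega>\<bar> = \<bar>\<Sum>s<S. V (\<pi> (Suc s)) \<omega> - V (\<pi> s) \<omega>\<bar>"
        using sum_lessThan_telescope[of "\<lambda>s. V (\<pi> s) \<omega>" S] by (rule arg_cong[OF sym])
      also have "\<dots> \<le> (\<Sum>s<S. \<bar>V (\<pi> (Suc s)) \<omega> - V (\<pi> s) \<omega>\<bar>)" by (rule sum_abs)
      also have "\<dots> \<le> (\<Sum>s<S. u s)" using step by (intro sum_mono) auto
      also have "\<dots> = A / 4 ^ S * (\<Sum>s<S. (4/5) ^ (S - s))" by (simp add: u_def sum_distrib_left)
      also have "\<dots> \<le> A / 4 ^ S * 4" using A sum_chain_weights_le by (intro mult_left_mono) auto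
      finally have "\<bar>V (\<pi> S) \<omega> - V (\<pi> 0) \<omega>\<bar> \<le> 4 * A / 4 ^ S" by (simp add: mult.commute)
      moreover have "\<pi> 0 = g0" using \<pi>(1)[of 0] N0 by simp
      moreover have "\<bar>V g \<omega> - V (\<pi> S) \<omega>\<bar> \<le> 2 * (C / 4 ^ S)"
        using \<pi>(2) C \<omega> by (intro lip g \<pi>U) auto
      ultimately show "\<bar>V g \<omega> - V g0 \<omega>\<bar> \<le> (4 * A + 2 * C) / 4 ^ S"
        by (simp add: add_divide_distrib)
    qed
  qed
qed

section \<open>Worst-case risk over a transport ball\<close>

lemma prob_space_empirical_measure: "n \<ge> 1 \<Longrightarrow> prob_space (empirical_measure n z)"
  unfolding empirical_measure_def
  by (intro prob_space.prob_space_distr prob_space_uniform_count_measure)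
     (auto simp: measurable_def space_uniform_count_measure sets_uniform_count_measure)

lemma nn_integral_empirical_measure:
  assumes "n \<ge> 1" and g: "g \<in> borel_measurable borel" "\<And>v. 0 \<le> g v"
  shows "(\<integral>\<^sup>+ v. ennreal (g v) \<partial>empirical_measure n z) = ennreal ((\<Sum>i=1..n. g (z i)) / real n)"
proof -
  have "z \<in> uniform_count_measure {1..n} \<rightarrow>\<^sub>M borel"
    by (auto simp: measurable_def space_uniform_count_measure sets_uniform_count_measure)
  then have "(\<integral>\<^sup>+ v. ennreal (g v) \<partial>empirical_measure n z)
      = (\<integral>\<^sup>+ i. ennreal (g (z i)) \<partial>uniform_count_measure {1..n})"
    unfolding empirical_measure_def using g by (subst nn_integral_distr) auto
  also have "\<dots> = (\<Sum>i=1..n. ennreal (1 / real n) * ennreal (g (z i)))"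
    by (simp add: uniform_count_measure_def nn_integral_point_measure_finite)
  also have "\<dots> = (\<Sum>i=1..n. ennreal (g (z i) / real n))"
    using g by (intro sum.cong) (auto simp: ennreal_mult[symmetric])
  also have "\<dots> = ennreal (\<Sum>i=1..n. g (z i) / real n)" using g by (intro sum_ennreal) auto
  finally show ?thesis by (simp add: sum_divide_distrib)
qed

lemma borel_measurable_l1_norm [measurable]: "l1_norm \<in> borel_measurable borel"
  unfolding l1_norm_def by measurable

lemma borel_measurable_transport_cost:
  "(\<lambda>(u, v). transport_cost u v) \<in> borel_measurable (borel :: (((real ^ 'd) \<times> real) \<times> ((real ^ 'd) \<times> real)) measure)"
  unfolding transport_cost_def case_prod_beta borel_prod[symmetric] by measurable

text \<open>The diagonal coupling costs nothing; hence a measure belongs to every transport ball around it.\<close>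

lemma transport_dist_self:
  fixes P :: "((real ^ 'd) \<times> real) measure"
  assumes "prob_space P" "sets P = sets borel"
  shows "transport_dist P P = 0"
proof -
  define \<pi> where "\<pi> = distr P borel (\<lambda>v. (v, v))"
  have [measurable]: "(\<lambda>v. (v, v)) \<in> P \<rightarrow>\<^sub>M borel"
    unfolding measurable_cong_sets[OF assms(2) refl] borel_prod[symmetric] by measurable
  have "distr \<pi> borel fst = P" "distr \<pi> borel snd = P"
  proof -
    have [measurable]: "fst \<in> (borel :: (((real ^ 'd) \<times> real) \<times> ((real ^ 'd) \<times> real)) measure) \<rightarrow>\<^sub>M borel"
      "snd \<in> (borel :: (((real ^ 'd) \<times> real) \<times> ((real ^ 'd) \<times> real)) measure) \<rightarrow>\<^sub>M borel"
      unfolding borel_prod[symmetric] by auto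
    show "distr \<pi> borel fst = P" "distr \<pi> borel snd = P"
      unfolding \<pi>_def using assms(2) by (subst distr_distr; simp add: comp_def distr_id2)+
  qed
  then have \<pi>: "\<pi> \<in> couplings P P"
    using assms(1) by (auto simp: couplings_def space_prob_algebra \<pi>_def intro!: prob_space.prob_space_distr)
  have "(\<integral>\<^sup>+ (u, v). transport_cost u v \<partial>\<pi>) = (\<integral>\<^sup>+ v. transport_cost v v \<partial>P)"
    unfolding \<pi>_def by (subst nn_integral_distr) (use borel_measurable_transport_cost in auto)
  also have "\<dots> = 0" by (simp add: transport_cost_def l1_norm_def)
  finally show ?thesis unfolding transport_dist_def using \<pi> by (metis INF_lower le_zero_eq)
qed

lemma worst_case_risk_ge:
  assumes "prob_space P" "sets P = sets borel"
  shows "(\<integral>\<^sup>+ (x, y). ennreal \<bar>y - f x\<bar> \<partial>P) \<le> worst_case_risk \<delta> P f"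
  unfolding worst_case_risk_def
  by (rule SUP_upper) (use assms transport_dist_self[OF assms] in \<open>auto simp: space_prob_algebra\<close>)

text \<open>Transport moves only the covariate, at the price of its \<open>l\<^sub>1\<close> displacement, so under a coupling the
expected loss of an \<open>l\<^sub>1\<close>-Lipschitz function changes by at most \<open>L\<close> times the transport cost.  The factor \<open>2\<close>
allows for a coupling that is not optimal.\<close>

lemma worst_case_risk_le:
  fixes f :: "real ^ 'd \<Rightarrow> real"
  assumes f: "\<And>x x'. \<bar>f x - f x'\<bar> \<le> L * l1_norm (x - x')" "f \<in> borel_measurable borel"
    and L: "L > 0" and \<delta>: "\<delta> > 0"
  shows "worst_case_risk \<delta> Q f \<le> (\<integral>\<^sup>+ (x, y). ennreal \<bar>y - f x\<bar> \<partial>Q) + ennreal (2 * \<delta> * L)"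
  unfolding worst_case_risk_def
proof (rule SUP_least)
  fix P :: "((real ^ 'd) \<times> real) measure"
  assume "P \<in> {P \<in> space (prob_algebra borel). transport_dist P Q \<le> ennreal \<delta>}"
  then have "transport_dist P Q \<le> ennreal \<delta>" by simp
  also have "\<dots> < ennreal (2 * \<delta>)" using \<delta> by (simp add: ennreal_less_iff)
  finally obtain \<pi> where \<pi>: "\<pi> \<in> couplings P Q" and c: "(\<integral>\<^sup>+ (u, v). transport_cost u v \<partial>\<pi>) < ennreal (2 * \<delta>)"
    unfolding transport_dist_def INF_less_iff by blast
  have s: "sets \<pi> = sets borel" and PQ: "P = distr \<pi> borel fst" "Q = distr \<pi> borel snd"
    using \<pi> by (auto simp: couplings_def space_prob_algebra)
  define loss where "loss = (\<lambda>(x, y). ennreal \<bar>y - f x\<bar>)"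
  have [measurable]: "f \<in> borel_measurable borel" by fact
  have loss [measurable]: "loss \<in> borel_measurable borel"
    unfolding loss_def borel_prod[symmetric] by measurable
  have [measurable]: "fst \<in> \<pi> \<rightarrow>\<^sub>M borel" "snd \<in> \<pi> \<rightarrow>\<^sub>M borel"
    unfolding measurable_cong_sets[OF s refl] borel_prod[symmetric] by auto
  have cost [measurable]: "(\<lambda>(u, v). transport_cost u v) \<in> borel_measurable \<pi>"
    unfolding measurable_cong_sets[OF s refl] by (rule borel_measurable_transport_cost)
  have pw: "loss u \<le> loss v + ennreal L * transport_cost u v" for u v
  proof (cases "snd u = snd v")
    case True
    have "\<bar>snd u - f (fst u)\<bar> \<le> \<bar>snd v - f (fst v)\<bar> + L * l1_norm (fst u - fst v)"
      using f(1)[of "fst u" "fst v"] True by linarith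
    then show ?thesis using True L
      by (simp add: loss_def case_prod_beta transport_cost_def l1_norm_def sum_nonneg
          ennreal_mult[symmetric] ennreal_plus[symmetric] ennreal_leI del: ennreal_plus)
  next
    case False
    then show ?thesis using L by (simp add: transport_cost_def ennreal_mult_top)
  qed
  have "(\<integral>\<^sup>+ v. loss v \<partial>P) = (\<integral>\<^sup>+ p. loss (fst p) \<partial>\<pi>)"
    unfolding PQ by (subst nn_integral_distr) auto
  also have "\<dots> \<le> (\<integral>\<^sup>+ p. loss (snd p) + ennreal L * (case p of (u, v) \<Rightarrow> transport_cost u v) \<partial>\<pi>)"
    by (intro nn_integral_mono) (use pw in \<open>auto split: prod.split\<close>)
  also have "\<dots> = (\<integral>\<^sup>+ p. loss (snd p) \<partial>\<pi>) + ennreal L * (\<integral>\<^sup>+ (u, v). transport_cost u v \<partial>\<pi>)"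
    by (subst nn_integral_add) (auto simp: nn_integral_cmult)
  also have "\<dots> \<le> (\<integral>\<^sup>+ p. loss (snd p) \<partial>\<pi>) + ennreal L * ennreal (2 * \<delta>)"
    using c by (intro add_left_mono mult_left_mono) auto
  also have "(\<integral>\<^sup>+ p. loss (snd p) \<partial>\<pi>) = (\<integral>\<^sup>+ v. loss v \<partial>Q)"
    unfolding PQ by (subst nn_integral_distr) auto
  finally show "(\<integral>\<^sup>+ (x, y). ennreal \<bar>y - f x\<bar> \<partial>P) \<le> (\<integral>\<^sup>+ (x, y). ennreal \<bar>y - f x\<bar> \<partial>Q) + ennreal (2 * \<delta> * L)"
    using L \<delta> by (simp add: loss_def case_prod_beta' ennreal_mult[symmetric] mult_ac)
qed

text \<open>The basic inequality: the robust objective dominates the empirical risk and exceeds it by at most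
\<open>2 \<delta> L\<close> at a Lipschitz competitor \<open>h\<close>.\<close>

lemma dro_minimizer_risk_le:
  fixes f h :: "real ^ 'd \<Rightarrow> real" and z :: "nat \<Rightarrow> (real ^ 'd) \<times> real"
  assumes n: "n \<ge> 1" and min: "worst_case_risk \<delta> (empirical_measure n z) f \<le> worst_case_risk \<delta> (empirical_measure n z) h"
    and h: "\<And>x x'. \<bar>h x - h x'\<bar> \<le> L * l1_norm (x - x')" "h \<in> borel_measurable borel"
    and f: "f \<in> borel_measurable borel" and L: "L > 0" and \<delta>: "\<delta> > 0"
  shows "(\<Sum>i=1..n. \<bar>snd (z i) - f (fst (z i))\<bar>) / real n
    \<le> (\<Sum>i=1..n. \<bar>snd (z i) - h (fst (z i))\<bar>) / real n + 2 * \<delta> * L"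
proof -
  have emp: "(\<integral>\<^sup>+ (x, y). ennreal \<bar>y - k x\<bar> \<partial>empirical_measure n z)
      = ennreal ((\<Sum>i=1..n. \<bar>snd (z i) - k (fst (z i))\<bar>) / real n)"
    if [measurable]: "k \<in> borel_measurable borel" for k
  proof -
    have "(\<lambda>v. \<bar>snd v - k (fst v)\<bar>) \<in> borel_measurable (borel :: ((real ^ 'd) \<times> real) measure)"
      unfolding borel_prod[symmetric] by measurable
    from nn_integral_empirical_measure[OF n this, of z] show ?thesis by (simp add: case_prod_beta')
  qed
  let ?S = "\<lambda>k. (\<Sum>i=1..n. \<bar>snd (z i) - k (fst (z i))\<bar>) / real n"
  have "ennreal (?S f) \<le> worst_case_risk \<delta> (empirical_measure n z) f"
    unfolding emp[OF f, symmetric]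
    by (rule worst_case_risk_ge[OF prob_space_empirical_measure[OF n]]) (simp add: empirical_measure_def)
  also note min
  also have "worst_case_risk \<delta> (empirical_measure n z) h \<le> ennreal (?S h) + ennreal (2 * \<delta> * L)"
    unfolding emp[OF h(2), symmetric] by (rule worst_case_risk_le[OF h L \<delta>])
  also have "\<dots> = ennreal (?S h + 2 * \<delta> * L)"
    using L \<delta> by (intro ennreal_plus[symmetric]) (auto intro!: divide_nonneg_nonneg sum_nonneg)
  finally show ?thesis
    using L \<delta> by (subst (asm) ennreal_le_iff) (auto intro!: add_nonneg_nonneg divide_nonneg_nonneg sum_nonneg)
qed

section \<open>Excess risk of the absolute loss\<close>

text \<open>For noise \<open>e\<close> with law \<open>\<mu>\<close> this is \<open>E |e - t| - E |e|\<close>; the difference is taken inside the integral so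
that it is bounded by \<open>|t|\<close>.\<close>

definition excess_risk :: "real measure \<Rightarrow> real \<Rightarrow> real" where
  "excess_risk \<mu> t = (\<integral>e. \<bar>e - t\<bar> - \<bar>e\<bar> \<partial>\<mu>)"

lemma integrable_excess_loss:
  fixes \<mu> :: "real measure"
  assumes "prob_space \<mu>" "sets \<mu> = sets borel"
  shows "integrable \<mu> (\<lambda>e. \<bar>e - t\<bar> - \<bar>e\<bar>)"
proof -
  interpret prob_space \<mu> by fact
  show ?thesis
    by (rule integrable_const_bound[of _ "\<bar>t\<bar>"]) (auto simp: measurable_cong_sets[OF assms(2) refl])
qed

lemma excess_risk_lipschitz:
  assumes "prob_space \<mu>" "sets \<mu> = sets borel"
  shows "\<bar>excess_risk \<mu> s - excess_risk \<mu> t\<bar> \<le> \<bar>s - t\<bar>"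
proof -
  interpret prob_space \<mu> by fact
  note int = integrable_excess_loss[OF assms]
  have "excess_risk \<mu> s - excess_risk \<mu> t = (\<integral>e. (\<bar>e - s\<bar> - \<bar>e\<bar>) - (\<bar>e - t\<bar> - \<bar>e\<bar>) \<partial>\<mu>)"
    unfolding excess_risk_def using int by (subst Bochner_Integration.integral_diff) auto
  also have "\<bar>\<dots>\<bar> \<le> (\<integral>e. \<bar>(\<bar>e - s\<bar> - \<bar>e\<bar>) - (\<bar>e - t\<bar> - \<bar>e\<bar>)\<bar> \<partial>\<mu>)" by (rule integral_abs_bound)
  also have "\<dots> \<le> (\<integral>e. \<bar>s - t\<bar> \<partial>\<mu>)"
    by (intro integral_mono integrable_abs Bochner_Integration.integrable_diff int) auto
  finally show ?thesis by (simp add: prob_space)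
qed

lemma excess_risk_zero [simp]: "excess_risk \<mu> 0 = 0"
  by (simp add: excess_risk_def)

lemma borel_measurable_excess_risk:
  assumes "prob_space \<mu>" "sets \<mu> = sets borel"
  shows "excess_risk \<mu> \<in> borel_measurable borel"
  by (rule borel_measurable_lipschitz[where L = 1]) (use excess_risk_lipschitz[OF assms] in simp)

lemma excess_risk_minus:
  assumes "sets \<mu> = sets borel" "symmetric_about_zero \<mu>"
  shows "excess_risk \<mu> (- t) = excess_risk \<mu> t"
proof -
  have "excess_risk \<mu> t = (\<integral>e. \<bar>e - t\<bar> - \<bar>e\<bar> \<partial>distr \<mu> borel uminus)"
    using assms(2) by (simp add: excess_risk_def symmetric_about_zero_def)
  also have "\<dots> = (\<integral>e. \<bar>- e - t\<bar> - \<bar>- e\<bar> \<partial>\<mu>)"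
    by (rule integral_distr) (auto simp: measurable_cong_sets[OF assms(1) refl])
  also have "\<dots> = excess_risk \<mu> (- t)"
    unfolding excess_risk_def by (rule Bochner_Integration.integral_cong) auto
  finally show ?thesis by simp
qed

text \<open>The loss difference equals \<open>t\<close> for \<open>e \<le> 0\<close> and is at least \<open>- t\<close> for \<open>e > 0\<close>; by symmetry these two bounds together
have a nonnegative mean.  For \<open>0 < e \<le> a\<close> the difference is \<open>t - 2 e \<ge> 0\<close>, which gains another \<open>t\<close> on an event of
probability \<open>\<mu> {0<..a}\<close>.\<close>

lemma excess_risk_nonneg_arg:
  assumes "prob_space \<mu>" "sets \<mu> = sets borel" "symmetric_about_zero \<mu>" and a: "0 \<le> a" "2 * a \<le> t"
  shows "t * measure \<mu> {0<..a} \<le> excess_risk \<mu> t"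
proof -
  interpret prob_space \<mu> by fact
  have [measurable_cong]: "sets \<mu> = sets borel" by fact
  have sp: "space \<mu> = UNIV" using sets_eq_imp_space_eq[OF assms(2)] by simp
  have "measure \<mu> {0<..} = measure (distr \<mu> borel uminus) {0<..}"
    using assms(3) by (simp add: symmetric_about_zero_def)
  also have "\<dots> = measure \<mu> {..<0}"
    by (subst measure_distr) (auto simp: sp intro!: arg_cong[where f="measure \<mu>"])
  also have "\<dots> \<le> measure \<mu> {..0}" by (rule finite_measure_mono) auto
  finally have sym: "measure \<mu> {0<..} \<le> measure \<mu> {..0}" .
  let ?I = "\<lambda>A e. indicator A e :: real"
  have "t * measure \<mu> {0<..a} \<le> t * (measure \<mu> {..0} - measure \<mu> {0<..}) + t * measure \<mu> {0<..a}"
    using sym a by simp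
  also have "\<dots> = (\<integral>e. t * (?I {..0} e - ?I {0<..} e) + t * ?I {0<..a} e \<partial>\<mu>)"
    by (simp add: emeasure_eq_measure)
  also have "\<dots> \<le> (\<integral>e. \<bar>e - t\<bar> - \<bar>e\<bar> \<partial>\<mu>)"
  proof (rule integral_mono)
    fix e
    show "t * (?I {..0} e - ?I {0<..} e) + t * ?I {0<..a} e \<le> \<bar>e - t\<bar> - \<bar>e\<bar>"
      using a by (auto simp: indicator_def)
  qed (use integrable_excess_loss[OF assms(1,2)] in \<open>auto simp: emeasure_eq_measure\<close>)
  finally show ?thesis by (simp add: excess_risk_def)
qed

text \<open>If \<open>\<mu>\<close> has mass of order \<open>a\<close> in \<open>{0<..a}\<close>, this is a substitute for the quadratic growth of the
excess risk.  It is linear in \<open>|t|\<close>, so averages over the sample need neither Jensen's inequality nor a distinction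
between small and large errors, and \<open>a\<close> may be chosen as the rate to be proved.\<close>

lemma excess_risk_ge:
  assumes "prob_space \<mu>" "sets \<mu> = sets borel" "symmetric_about_zero \<mu>" "0 \<le> a"
  shows "(\<bar>t\<bar> - 2 * a) * measure \<mu> {0<..a} \<le> excess_risk \<mu> t"
proof -
  have eq: "excess_risk \<mu> t = excess_risk \<mu> \<bar>t\<bar>"
    using excess_risk_minus[OF assms(2,3), of t] by (simp add: abs_if)
  show ?thesis
  proof (cases "2 * a \<le> \<bar>t\<bar>")
    case True
    have "(\<bar>t\<bar> - 2 * a) * measure \<mu> {0<..a} \<le> \<bar>t\<bar> * measure \<mu> {0<..a}"
      using assms(4) by (intro mult_right_mono) auto
    then show ?thesis using excess_risk_nonneg_arg[OF assms True] eq by simp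
  next
    case False
    then have "(\<bar>t\<bar> - 2 * a) * measure \<mu> {0<..a} \<le> 0" by (intro mult_nonpos_nonneg) auto
    moreover have "0 \<le> excess_risk \<mu> \<bar>t\<bar>"
      using excess_risk_nonneg_arg[OF assms(1-3), of 0 "\<bar>t\<bar>"] by simp
    ultimately show ?thesis using eq by linarith
  qed
qed

lemma measure_near_zero_ge:
  assumes "prob_space \<mu>" "continuous_positive_density_near_zero \<mu>"
  shows "\<exists>p0>0. \<exists>a0>0. \<forall>a. 0 < a \<longrightarrow> a \<le> a0 \<longrightarrow> p0 * a \<le> measure \<mu> {0<..a}"
proof -
  interpret prob_space \<mu> by fact
  obtain U p where U: "open U" "0 \<in> U" "continuous_on U p" "\<And>t. t \<in> U \<Longrightarrow> 0 < p t"
    and dens: "\<And>A. A \<in> sets borel \<Longrightarrow> A \<subseteq> U \<Longrightarrow> emeasure \<mu> A = (\<integral>\<^sup>+ t\<in>A. ennreal (p t) \<partial>lborel)"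
    using assms(2) unfolding continuous_positive_density_near_zero_def by blast
  obtain r where r: "r > 0" "ball 0 r \<subseteq> U" using U(1,2) openE by blast
  obtain s where s: "s > 0" "\<And>t. t \<in> U \<Longrightarrow> dist t 0 < s \<Longrightarrow> dist (p t) (p 0) < p 0 / 2"
    using U(2,3) U(4)[OF U(2)] unfolding continuous_on_iff by (meson half_gt_zero)
  define a0 where "a0 = min r s / 2"
  have p0: "p 0 > 0" using U by blast
  have a0: "a0 > 0" using r s by (auto simp: a0_def)
  have "p 0 / 2 * a \<le> measure \<mu> {0<..a}" if a: "0 < a" "a \<le> a0" for a
  proof -
    have sub: "t \<in> U \<and> p 0 / 2 \<le> p t" if "t \<in> {0<..a}" for t
    proof -
      have *: "\<bar>t\<bar> < r" "\<bar>t\<bar> < s" using that a r s by (auto simp: a0_def)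
      then have "t \<in> U" using r by (auto simp: dist_norm)
      with s(2)[OF this] * have "\<bar>p t - p 0\<bar> < p 0 / 2" by (simp add: dist_real_def)
      with \<open>t \<in> U\<close> show ?thesis by linarith
    qed
    have "ennreal (p 0 / 2 * a) = ennreal (p 0 / 2) * emeasure lborel {0<..a}"
      using a p0 by (simp add: ennreal_mult[symmetric])
    also have "\<dots> = (\<integral>\<^sup>+ t\<in>{0<..a}. ennreal (p 0 / 2) \<partial>lborel)" by (simp add: nn_integral_cmult_indicator)
    also have "\<dots> \<le> (\<integral>\<^sup>+ t\<in>{0<..a}. ennreal (p t) \<partial>lborel)"
      using sub by (intro nn_integral_mono) (auto simp: indicator_def intro!: ennreal_leI)
    also have "\<dots> = emeasure \<mu> {0<..a}" using sub by (intro dens[symmetric]) auto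
    finally show "p 0 / 2 * a \<le> measure \<mu> {0<..a}"
      using p0 a by (simp add: emeasure_eq_measure)
  qed
  moreover have "p 0 / 2 > 0" using p0 by simp
  ultimately show ?thesis using a0 by blast
qed

section \<open>The centred noise process\<close>

text \<open>Transforming \<open>W\<close> to a real variable gives two variables of the same type, to which product measures
and Fubini's theorem apply.\<close>

lemma (in prob_space) indep_rvs_imp_indep_var:
  fixes V :: "'a \<Rightarrow> real" and W :: "'a \<Rightarrow> 'b::topological_space" and \<tau> :: "'b \<Rightarrow> real"
  assumes "indep_rvs M V W" and \<tau>: "\<tau> \<in> borel_measurable borel"
  shows "indep_var borel V borel (\<lambda>\<omega>. \<tau> (W \<omega>))"
proof -
  have V: "V \<in> borel_measurable M" and W: "W \<in> borel_measurable M"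
    and ind: "indep_set {V -` A \<inter> space M | A. A \<in> sets borel} {W -` B \<inter> space M | B. B \<in> sets borel}"
    using assms(1) by (auto simp: indep_rvs_def)
  have stable: "Int_stable {f -` A \<inter> space M | A. A \<in> sets borel}" for f :: "'a \<Rightarrow> real"
  proof (rule Int_stableI, clarsimp)
    fix A B :: "real set" assume "A \<in> sets borel" "B \<in> sets borel"
    then show "\<exists>C. f -` A \<inter> space M \<inter> (f -` B \<inter> space M) = f -` C \<inter> space M \<and> C \<in> sets borel"
      by (intro exI[of _ "A \<inter> B"]) auto
  qed
  have "{(\<lambda>\<omega>. \<tau> (W \<omega>)) -` B \<inter> space M | B. B \<in> sets borel} \<subseteq> {W -` B \<inter> space M | B. B \<in> sets borel}"
  proof clarsimp
    fix B :: "real set" assume "B \<in> sets borel"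
    then have "\<tau> -` B \<in> sets borel" using measurable_sets[OF \<tau>, of B] by simp
    then show "\<exists>C. (\<lambda>\<omega>. \<tau> (W \<omega>)) -` B \<inter> space M = W -` C \<inter> space M \<and> C \<in> sets borel"
      by (intro exI[of _ "\<tau> -` B"]) auto
  qed
  then have "indep_set {V -` A \<inter> space M | A. A \<in> sets borel} {(\<lambda>\<omega>. \<tau> (W \<omega>)) -` B \<inter> space M | B. B \<in> sets borel}"
    using ind unfolding indep_set_def
    by (elim indep_sets_mono_sets) (auto split: bool.splits)
  from indep_set_sigma_sets[OF this stable stable] show ?thesis
    unfolding indep_var_eq using V W \<tau> by (auto intro: measurable_compose[OF W])
qed

text \<open>The loss difference minus its conditional mean given the regression error \<open>t\<close>.\<close>

definition centred_loss :: "real measure \<Rightarrow> real \<Rightarrow> real \<Rightarrow> real" where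
  "centred_loss \<mu> t e = \<bar>e - t\<bar> - \<bar>e\<bar> - excess_risk \<mu> t"

lemma centred_loss_lipschitz:
  assumes "prob_space \<mu>" "sets \<mu> = sets borel"
  shows "\<bar>centred_loss \<mu> s e - centred_loss \<mu> t e\<bar> \<le> 2 * \<bar>s - t\<bar>"
proof -
  have "\<bar>\<bar>e - s\<bar> - \<bar>e - t\<bar>\<bar> \<le> \<bar>s - t\<bar>" by linarith
  moreover have "\<bar>u - v\<bar> \<le> \<bar>u\<bar> + \<bar>v\<bar>" for u v :: real by linarith
  note this[of "\<bar>e - s\<bar> - \<bar>e - t\<bar>" "excess_risk \<mu> s - excess_risk \<mu> t"]
  moreover have "centred_loss \<mu> s e - centred_loss \<mu> t e = (\<bar>e - s\<bar> - \<bar>e - t\<bar>) - (excess_risk \<mu> s - excess_risk \<mu> t)"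
    by (simp add: centred_loss_def)
  ultimately show ?thesis using excess_risk_lipschitz[OF assms, of s t] by argo
qed

lemma borel_measurable_centred_loss:
  assumes "prob_space \<mu>" "sets \<mu> = sets borel"
  shows "(\<lambda>(e, t). centred_loss \<mu> t e) \<in> borel_measurable (borel \<Otimes>\<^sub>M borel)"
proof -
  note [measurable] = borel_measurable_excess_risk[OF assms]
  show ?thesis unfolding centred_loss_def by measurable
qed

text \<open>By independence the law of \<open>(e, T)\<close> is a product, and integrating over \<open>e\<close> first gives \<open>0\<close> for every
value of \<open>T\<close>.\<close>

lemma (in prob_space) expectation_centred_loss:
  assumes indep: "indep_var borel e borel T" and T: "\<And>\<omega>. \<omega> \<in> space M \<Longrightarrow> \<bar>T \<omega>\<bar> \<le> K"
  defines "\<mu> \<equiv> distr M borel e"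
  shows "expectation (\<lambda>\<omega>. centred_loss \<mu> (T \<omega>) (e \<omega>)) = 0"
proof -
  have [measurable]: "T \<in> borel_measurable M" "e \<in> borel_measurable M"
    and prod: "distr M borel e \<Otimes>\<^sub>M distr M borel T = distr M (borel \<Otimes>\<^sub>M borel) (\<lambda>\<omega>. (e \<omega>, T \<omega>))"
    using indep unfolding indep_var_distribution_eq by auto
  have \<mu>: "prob_space \<mu>" "sets \<mu> = sets borel" unfolding \<mu>_def by (auto intro: prob_space_distr)
  note [measurable] = borel_measurable_centred_loss[OF \<mu>]
  interpret P1: prob_space "distr M borel T" by (rule prob_space_distr) measurable
  interpret P2: prob_space "distr M borel e" by (rule prob_space_distr) measurable
  interpret P: pair_sigma_finite "distr M borel e" "distr M borel T" ..
  have bound: "\<bar>centred_loss \<mu> (T \<omega>) (e \<omega>)\<bar> \<le> 2 * K" if "\<omega> \<in> space M" for \<omega>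
    using centred_loss_lipschitz[OF \<mu>, of "T \<omega>" "e \<omega>" 0] T[OF that] by (simp add: centred_loss_def)
  have "integrable M (\<lambda>\<omega>. (\<lambda>(e, t). centred_loss \<mu> t e) (e \<omega>, T \<omega>))"
    by (rule integrable_const_bound[of _ "2 * K"]) (use bound in \<open>auto intro!: AE_I2\<close>)
  then have int: "integrable (distr M borel e \<Otimes>\<^sub>M distr M borel T) (\<lambda>(e, t). centred_loss \<mu> t e)"
    unfolding prod by (subst integrable_distr_eq) auto
  have inner: "(\<integral>e. centred_loss \<mu> t e \<partial>\<mu>) = 0" for t
  proof -
    interpret Q: prob_space \<mu> by fact
    show ?thesis unfolding centred_loss_def
      by (subst Bochner_Integration.integral_diff[OF integrable_excess_loss[OF \<mu>]])
        (auto simp: excess_risk_def Q.prob_space)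
  qed
  have "expectation (\<lambda>\<omega>. centred_loss \<mu> (T \<omega>) (e \<omega>))
      = integral\<^sup>L (distr M borel e \<Otimes>\<^sub>M distr M borel T) (\<lambda>(e, t). centred_loss \<mu> t e)"
    unfolding prod by (subst integral_distr) auto
  also have "\<dots> = (\<integral>t. (\<integral>e. centred_loss \<mu> t e \<partial>\<mu>) \<partial>distr M borel T)"
    using P.integral_snd[OF int] unfolding \<mu>_def by simp
  finally show ?thesis unfolding inner by simp
qed

text \<open>The regression error at \<open>x\<close>, expressed through the rescaled functions \<open>g\<close> and \<open>g0\<close>, as long as the covariate stays in
the ball of radius \<open>R\<close>.  Setting it to \<open>0\<close> elsewhere makes the summands of the noise process bounded, so that
Hoeffding's inequality applies to the pairs \<open>(X i, e i)\<close> without conditioning on the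
covariates.\<close>

definition truncated_error ::
    "real \<Rightarrow> real \<Rightarrow> (real ^ 'd \<Rightarrow> real) \<Rightarrow> (real ^ 'd \<Rightarrow> real) \<Rightarrow> real ^ 'd \<Rightarrow> real" where
  "truncated_error R B g0 g x = (if norm x \<le> R then B * (g (x /\<^sub>R R) - g0 (x /\<^sub>R R)) else 0)"

text \<open>Division by \<open>B\<close> makes the increments comparable to the distance of the rescaled functions.\<close>

definition noise_process ::
    "real measure \<Rightarrow> real \<Rightarrow> real \<Rightarrow> (real ^ 'd \<Rightarrow> real) \<Rightarrow> nat \<Rightarrow> (nat \<Rightarrow> 'w \<Rightarrow> real ^ 'd) \<Rightarrow> (nat \<Rightarrow> 'w \<Rightarrow> real)
      \<Rightarrow> (real ^ 'd \<Rightarrow> real) \<Rightarrow> 'w \<Rightarrow> real" where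
  "noise_process \<mu> R B g0 n X e g \<omega> =
     (\<Sum>i=1..n. centred_loss \<mu> (truncated_error R B g0 g (X i \<omega>)) (e i \<omega>)) / (real n * B)"

lemma borel_measurable_unit_convex_class:
  "g \<in> unit_convex_class \<Longrightarrow> g \<in> borel_measurable borel"
  by (rule borel_measurable_lipschitz[where L = 1]) (auto simp: unit_convex_class_def)

text \<open>An increment is a mean of \<open>n\<close> independent centred terms, each bounded by \<open>2 \<rho>\<close> after division by \<open>B\<close>
when the two functions differ by at most \<open>\<rho>\<close> on the unit ball.\<close>

lemma (in prob_space) subgaussian_noise_process:
  fixes X :: "nat \<Rightarrow> 'a \<Rightarrow> real ^ 'd" and e :: "nat \<Rightarrow> 'a \<Rightarrow> real"
  assumes indep: "indep_vars (\<lambda>_. borel) (\<lambda>i \<omega>. (X i \<omega>, e i \<omega>)) {1..}"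
    and noise: "\<And>i. i \<ge> 1 \<Longrightarrow> indep_rvs M (e i) (X i)"
    and law: "\<And>i. i \<ge> 1 \<Longrightarrow> distr M borel (e i) = \<mu>"
    and R: "R > 0" and B: "B > 0" and n: "n \<ge> 1" and g0: "g0 \<in> unit_convex_class"
  shows "subgaussian_process M n (noise_process \<mu> R B g0 n X e)"
proof -
  have Xm [measurable]: "X i \<in> borel_measurable M" and em [measurable]: "e i \<in> borel_measurable M" if "i \<ge> 1" for i
    using noise[OF that] by (auto simp: indep_rvs_def)
  have \<mu>: "prob_space \<mu>" "sets \<mu> = sets borel"
    using prob_space_distr[OF em[of 1]] law[of 1] by auto
  let ?T = "truncated_error R B g0"
  define w where "w g = (\<lambda>(x, t). centred_loss \<mu> (?T g x) t)" for g :: "real ^ 'd \<Rightarrow> real"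
  have Tm: "?T g \<in> borel_measurable borel" if "g \<in> unit_convex_class" for g
  proof -
    note [measurable] = borel_measurable_unit_convex_class[OF that] borel_measurable_unit_convex_class[OF g0]
    show ?thesis unfolding truncated_error_def by measurable
  qed
  have wm: "w g \<in> borel_measurable borel" if "g \<in> unit_convex_class" for g
  proof -
    note [measurable] = Tm[OF that] borel_measurable_excess_risk[OF \<mu>]
    show ?thesis unfolding w_def centred_loss_def borel_prod[symmetric] by measurable
  qed
  have Tdiff: "\<bar>?T g x - ?T h x\<bar> \<le> B * \<rho>"
    if "\<forall>x. norm x \<le> 1 \<longrightarrow> \<bar>g x - h x\<bar> \<le> \<rho>" "\<rho> > 0" for g h \<rho> x
  proof (cases "norm x \<le> R")
    case True
    then have "norm (x /\<^sub>R R) \<le> 1" using R by (simp add: field_simps)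
    then have "\<bar>g (x /\<^sub>R R) - h (x /\<^sub>R R)\<bar> \<le> \<rho>" using that by blast
    moreover have "?T g x - ?T h x = B * (g (x /\<^sub>R R) - h (x /\<^sub>R R))"
      using True by (simp add: truncated_error_def algebra_simps)
    ultimately show ?thesis using B by (simp add: abs_mult)
  qed (use B that in \<open>simp add: truncated_error_def\<close>)
  have wdiff: "\<bar>w g v - w h v\<bar> \<le> 2 * B * \<rho>"
    if "\<forall>x. norm x \<le> 1 \<longrightarrow> \<bar>g x - h x\<bar> \<le> \<rho>" "\<rho> > 0" for g h \<rho> v
  proof -
    have "2 * \<bar>?T g (fst v) - ?T h (fst v)\<bar> \<le> 2 * (B * \<rho>)" by (intro mult_left_mono Tdiff that) auto
    with centred_loss_lipschitz[OF \<mu>, of "?T g (fst v)" "snd v" "?T h (fst v)"]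
    show ?thesis unfolding w_def case_prod_beta mult.assoc by (rule order_trans)
  qed
  have mean: "expectation (\<lambda>\<omega>. w g (X i \<omega>, e i \<omega>)) = 0" if "g \<in> unit_convex_class" "i \<ge> 1" for g i
  proof -
    have "\<bar>?T g x\<bar> \<le> B * 10" for x
    proof -
      have "\<bar>?T g x - ?T g0 x\<bar> \<le> B * 10"
        by (rule Tdiff) (use unit_convex_class_diff_le[OF that(1) g0] in auto)
      moreover have "?T g0 x = 0" by (simp add: truncated_error_def)
      ultimately show ?thesis by simp
    qed
    moreover have "indep_var borel (e i) borel (\<lambda>\<omega>. ?T g (X i \<omega>))"
      by (rule indep_rvs_imp_indep_var[OF noise[OF that(2)] Tm[OF that(1)]])
    ultimately show ?thesis
      using expectation_centred_loss[of "e i" "\<lambda>\<omega>. ?T g (X i \<omega>)" "B * 10"] law[OF that(2)]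
      by (simp add: w_def)
  qed
  have V: "noise_process \<mu> R B g0 n X e g \<omega> = (\<Sum>i=1..n. w g (X i \<omega>, e i \<omega>)) / (real n * B)" for g \<omega>
    by (simp add: noise_process_def w_def)
  have wi [measurable]: "(\<lambda>\<omega>. w g (X i \<omega>, e i \<omega>)) \<in> borel_measurable M" if "g \<in> unit_convex_class" "i \<ge> 1" for g i
    using wm[OF that(1)] Xm[OF that(2)] em[OF that(2)] by measurable
  show ?thesis
    unfolding subgaussian_process_def
  proof (intro conjI ballI allI impI)
    fix g :: "real ^ 'd \<Rightarrow> real" assume g: "g \<in> unit_convex_class"
    show "noise_process \<mu> R B g0 n X e g \<in> borel_measurable M"
      unfolding V using wi[OF g] by (intro borel_measurable_divide borel_measurable_sum) auto
    fix h :: "real ^ 'd \<Rightarrow> real" and \<rho> :: real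
    assume h: "h \<in> unit_convex_class" and \<rho>: "\<rho> > 0" "\<forall>x. norm x \<le> 1 \<longrightarrow> \<bar>g x - h x\<bar> \<le> \<rho>"
    define W where "W i \<omega> = w g (X i \<omega>, e i \<omega>) - w h (X i \<omega>, e i \<omega>)" for i \<omega>
    have W: "\<bar>W i \<omega>\<bar> \<le> 2 * B * \<rho>" for i \<omega> unfolding W_def by (rule wdiff[OF \<rho>(2,1)])
    have VV: "noise_process \<mu> R B g0 n X e g \<omega> - noise_process \<mu> R B g0 n X e h \<omega> = (\<Sum>i=1..n. W i \<omega>) / (real n * B)" for \<omega>
      by (simp add: V W_def sum_subtractf diff_divide_distrib)
    {
      fix \<omega>
      have "\<bar>\<Sum>i=1..n. W i \<omega>\<bar> \<le> (\<Sum>i=1..n. \<bar>W i \<omega>\<bar>)" by (rule sum_abs)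
      also have "\<dots> \<le> (\<Sum>i=1..n. 2 * B * \<rho>)" by (intro sum_mono W)
      finally show "\<bar>noise_process \<mu> R B g0 n X e g \<omega> - noise_process \<mu> R B g0 n X e h \<omega>\<bar> \<le> 2 * \<rho>"
        unfolding VV using n B by (simp add: abs_mult field_simps)
    }
    fix u :: real assume u: "u \<ge> 0"
    have Wint: "expectation (W i) = 0" if "i \<in> {1..n}" for i
    proof -
      have i: "i \<ge> 1" using that by simp
      have int: "integrable M (\<lambda>\<omega>. w k (X i \<omega>, e i \<omega>))" if k: "k \<in> unit_convex_class" for k
      proof -
        have b: "\<bar>w k v - w g0 v\<bar> \<le> 2 * B * 10" for v
          by (rule wdiff) (use unit_convex_class_diff_le[OF k g0] in auto)
        have "w g0 v = 0" for v by (simp add: w_def truncated_error_def centred_loss_def case_prod_beta)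
        with b show ?thesis using wi[OF k i] by (intro integrable_const_bound[of _ "2 * B * 10"]) auto
      qed
      show ?thesis unfolding W_def using mean[OF g i] mean[OF h i]
        by (subst Bochner_Integration.integral_diff[OF int[OF g] int[OF h]]) simp
    qed
    interpret H: Hoeffding_ineq M "{1..n}" W "\<lambda>_. - (2 * B * \<rho>)" "\<lambda>_. 2 * B * \<rho>" "0"
    proof unfold_locales
      have "indep_vars (\<lambda>_. borel) (\<lambda>i \<omega>. (\<lambda>v. w g v - w h v) (X i \<omega>, e i \<omega>)) {1..n}"
        by (rule indep_vars_compose2[OF indep_vars_subset[OF indep]]) (use wm g h in auto)
      then show "indep_vars (\<lambda>_. borel) W {1..n}" by (simp add: W_def[abs_def])
      show "AE \<omega> in M. W i \<omega> \<in> {- (2 * B * \<rho>)..2 * B * \<rho>}" for i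
      proof (rule AE_I2)
        fix \<omega>
        show "W i \<omega> \<in> {- (2 * B * \<rho>)..2 * B * \<rho>}" using W[of i \<omega>] unfolding atLeastAtMost_iff by linarith
      qed
      show "0 \<equiv> \<Sum>i=1..n. expectation (W i)" using Wint by (simp add: eq_reflection)
    qed simp
    have sumsq: "(\<Sum>i=1..n. (2 * B * \<rho> - - (2 * B * \<rho>))\<^sup>2) = real n * (16 * (B\<^sup>2 * \<rho>\<^sup>2))"
      by (simp add: power2_eq_square algebra_simps)
    have "measure M {\<omega> \<in> space M. u \<le> \<bar>noise_process \<mu> R B g0 n X e g \<omega> - noise_process \<mu> R B g0 n X e h \<omega>\<bar>}
      = measure M {\<omega> \<in> space M. \<bar>(\<Sum>i=1..n. W i \<omega>) - 0\<bar> \<ge> real n * B * u}"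
      unfolding VV using n B by (intro arg_cong[where f="measure M"]) (auto simp: abs_mult field_simps)
    also have "\<dots> \<le> 2 * exp (- 2 * (real n * B * u)\<^sup>2 / (real n * (16 * (B\<^sup>2 * \<rho>\<^sup>2))))"
      unfolding sumsq[symmetric]
      by (rule H.Hoeffding_ineq_abs_ge) (use n B u \<rho> in \<open>auto simp: sumsq[simplified]\<close>)
    also have "- 2 * (real n * B * u)\<^sup>2 / (real n * (16 * (B\<^sup>2 * \<rho>\<^sup>2))) = - (real n * u\<^sup>2 / (8 * \<rho>\<^sup>2))"
      using n B by (simp add: field_simps power2_eq_square)
    finally show "measure M {\<omega> \<in> space M. u \<le> \<bar>noise_process \<mu> R B g0 n X e g \<omega> - noise_process \<mu> R B g0 n X e h \<omega>\<bar>}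
      \<le> 2 * exp (- (real n * u\<^sup>2 / (8 * \<rho>\<^sup>2)))" .
  qed
qed

section \<open>From a bound on the noise to a bound on the loss\<close>

lemma rescaled_in_unit_convex_class:
  fixes f :: "real ^ 'd \<Rightarrow> real"
  assumes f: "convex_on UNIV f" and lip: "\<And>x y. \<bar>f x - f y\<bar> \<le> B / R * norm (x - y)"
    and f0: "\<bar>f 0\<bar> \<le> 4 * B" and R: "R > 0" and B: "B > 0"
  shows "(\<lambda>u. f (R *\<^sub>R u) / B) \<in> unit_convex_class"
  unfolding unit_convex_class_def
proof (intro CollectI conjI allI)
  show "convex_on UNIV (\<lambda>u. f (R *\<^sub>R u) / B)"
  proof (rule convex_onI)
    fix t :: real and x y :: "real ^ 'd" assume t: "0 < t" "t < 1"
    have "f (R *\<^sub>R ((1 - t) *\<^sub>R x + t *\<^sub>R y)) = f ((1 - t) *\<^sub>R (R *\<^sub>R x) + t *\<^sub>R (R *\<^sub>R y))"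
      by (simp add: algebra_simps)
    also have "\<dots> \<le> (1 - t) * f (R *\<^sub>R x) + t * f (R *\<^sub>R y)"
      using t by (intro convex_onD[OF f]) auto
    finally have "f (R *\<^sub>R ((1 - t) *\<^sub>R x + t *\<^sub>R y)) / B \<le> ((1 - t) * f (R *\<^sub>R x) + t * f (R *\<^sub>R y)) / B"
      using B by (intro divide_right_mono) auto
    then show "f (R *\<^sub>R ((1 - t) *\<^sub>R x + t *\<^sub>R y)) / B \<le> (1 - t) * (f (R *\<^sub>R x) / B) + t * (f (R *\<^sub>R y) / B)"
      by (simp add: add_divide_distrib)
  qed simp
  fix x y :: "real ^ 'd"
  have "\<bar>f (R *\<^sub>R x) / B - f (R *\<^sub>R y) / B\<bar> = \<bar>f (R *\<^sub>R x) - f (R *\<^sub>R y)\<bar> / B"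
    using B by (simp add: diff_divide_distrib[symmetric] abs_divide)
  also have "\<dots> \<le> (B / R * norm (R *\<^sub>R x - R *\<^sub>R y)) / B"
    using B by (intro divide_right_mono lip) auto
  also have "\<dots> = norm (x - y)"
    using R B by (simp add: scaleR_diff_right[symmetric])
  finally show "\<bar>f (R *\<^sub>R x) / B - f (R *\<^sub>R y) / B\<bar> \<le> norm (x - y)" .
  show "\<bar>f (R *\<^sub>R 0) / B\<bar> \<le> 4" using f0 B by (simp add: abs_divide field_simps)
qed

lemma euclidean_lipschitz:
  fixes f :: "real ^ 'd \<Rightarrow> real"
  assumes "\<And>x y. \<bar>f x - f y\<bar> \<le> L * l1_norm (x - y)" "0 \<le> L"
  shows "\<bar>f x - f y\<bar> \<le> L * real CARD('d) * norm (x - y)"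
proof -
  have "L * l1_norm (x - y) \<le> L * (real CARD('d) * norm (x - y))"
    using assms(2) by (intro mult_left_mono l1_norm_le)
  then show ?thesis using assms(1)[of x y] by (simp add: mult.assoc)
qed

text \<open>The deterministic core.  The basic inequality first shows that the errors are moderate on average, hence at some sample
point, hence (by the Lipschitz bounds) at the origin; so the rescaled \<open>f\<close> belongs to the class over which the noise
is controlled.  Then the empirical excess risk \<open>b\<close> and the noise bound the mean of
\<open>excess_risk\<close> over the sample, and the margin condition converts this into a bound on the mean error.\<close>

lemma l1_loss_bound:
  fixes f f\<^sub>0 :: "real ^ 'd \<Rightarrow> real" and X :: "nat \<Rightarrow> 'w \<Rightarrow> real ^ 'd" and \<epsilon> :: "nat \<Rightarrow> 'w \<Rightarrow> real"
    and \<omega> :: 'w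
  defines "x \<equiv> \<lambda>i. X i \<omega>" and "e \<equiv> \<lambda>i. \<epsilon> i \<omega>"
  assumes n: "n \<ge> 1" and l: "l > 0" and R: "R > 0"
    and f: "convex_on UNIV f" "\<And>x y. \<bar>f x - f y\<bar> \<le> l * norm (x - y)"
    and f0: "\<And>x y. \<bar>f\<^sub>0 x - f\<^sub>0 y\<bar> \<le> l * norm (x - y)"
    and x: "\<And>i. i \<in> {1..n} \<Longrightarrow> norm (x i) \<le> R"
    and e: "(\<Sum>i=1..n. \<bar>e i\<bar>) / real n \<le> K"
    and B: "2 * K + b + \<bar>f\<^sub>0 0\<bar> \<le> 2 * (l * R)"
    and basic: "(\<Sum>i=1..n. \<bar>e i - (f (x i) - f\<^sub>0 (x i))\<bar>) / real n \<le> (\<Sum>i=1..n. \<bar>e i\<bar>) / real n + b"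
    and noise: "\<And>g. g \<in> unit_convex_class \<Longrightarrow>
      \<bar>noise_process \<mu> R (l * R) (\<lambda>u. f\<^sub>0 (R *\<^sub>R u) / (l * R)) n X \<epsilon> g \<omega>\<bar> \<le> \<eta>"
    and margin: "\<And>t. p0 * a * (\<bar>t\<bar> - 2 * a) \<le> excess_risk \<mu> t" and pa: "p0 * a > 0"
  shows "empirical_l1_loss n x f f\<^sub>0 \<le> 2 * a + (b + l * R * \<eta>) / (p0 * a)"
proof -
  define t where "t i = f (x i) - f\<^sub>0 (x i)" for i
  define B where "B = l * R"
  have Bpos: "B > 0" using l R by (simp add: B_def)
  have n0: "real n > 0" using n by simp
  have avg: "(\<Sum>i=1..n. \<bar>t i\<bar>) / real n \<le> 2 * K + b"
  proof -
    have "(\<Sum>i=1..n. \<bar>t i\<bar>) \<le> (\<Sum>i=1..n. \<bar>e i - t i\<bar> + \<bar>e i\<bar>)" by (intro sum_mono) linarith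
    then have "(\<Sum>i=1..n. \<bar>t i\<bar>) / real n \<le> (\<Sum>i=1..n. \<bar>e i - t i\<bar> + \<bar>e i\<bar>) / real n"
      using n0 by (intro divide_right_mono) auto
    also have "\<dots> = (\<Sum>i=1..n. \<bar>e i - t i\<bar>) / real n + (\<Sum>i=1..n. \<bar>e i\<bar>) / real n"
      by (simp add: sum.distrib add_divide_distrib)
    finally show ?thesis using basic e by (simp add: t_def)
  qed
  have "\<exists>i\<in>{1..n}. \<bar>t i\<bar> \<le> 2 * K + b"
  proof (rule ccontr)
    assume "\<not> ?thesis"
    then have "(\<Sum>i=1..n. 2 * K + b) < (\<Sum>i=1..n. \<bar>t i\<bar>)" using n by (intro sum_strict_mono) (auto simp: not_le)
    then show False using avg n0 by (simp add: field_simps)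
  qed
  then obtain i where i: "i \<in> {1..n}" "\<bar>t i\<bar> \<le> 2 * K + b" by blast
  have "l * norm (x i) \<le> B" unfolding B_def using x[OF i(1)] l by (intro mult_left_mono) auto
  then have f_at_0: "\<bar>f 0\<bar> \<le> 4 * B"
    using f(2)[of 0 "x i"] f0[of 0 "x i"] i(2) B
    unfolding t_def B_def[symmetric] norm_minus_commute[of 0] diff_zero by linarith
  define g where "g = (\<lambda>u. f (R *\<^sub>R u) / B)"
  have g: "g \<in> unit_convex_class"
    unfolding g_def using f f_at_0 R Bpos
    by (intro rescaled_in_unit_convex_class) (auto simp: B_def)
  have "truncated_error R B (\<lambda>u. f\<^sub>0 (R *\<^sub>R u) / B) g (x i) = t i" if "i \<in> {1..n}" for i
    using x[OF that] R Bpos by (simp add: truncated_error_def g_def t_def right_diff_distrib)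
  then have V: "noise_process \<mu> R B (\<lambda>u. f\<^sub>0 (R *\<^sub>R u) / B) n X \<epsilon> g \<omega>
      = (\<Sum>i=1..n. centred_loss \<mu> (t i) (e i)) / (real n * B)"
    unfolding noise_process_def x_def e_def by (intro arg_cong2[where f="(/)"] sum.cong) auto
  have "- ((\<Sum>i=1..n. centred_loss \<mu> (t i) (e i)) / (real n * B)) \<le> \<eta>"
    using noise[OF g] unfolding B_def[symmetric] V by (rule order_trans[OF abs_ge_minus_self])
  then have cl: "- (\<Sum>i=1..n. centred_loss \<mu> (t i) (e i)) / real n \<le> B * \<eta>"
    using Bpos n0 by (simp add: field_simps)
  have "(\<Sum>i=1..n. excess_risk \<mu> (t i)) = (\<Sum>i=1..n. \<bar>e i - t i\<bar>) - (\<Sum>i=1..n. \<bar>e i\<bar>) - (\<Sum>i=1..n. centred_loss \<mu> (t i) (e i))"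
    by (simp add: centred_loss_def sum_subtractf)
  then have ex: "(\<Sum>i=1..n. excess_risk \<mu> (t i)) / real n \<le> b + B * \<eta>"
    using basic cl by (simp add: t_def[symmetric] diff_divide_distrib)
  have "(\<Sum>i=1..n. p0 * a * (\<bar>t i\<bar> - 2 * a)) / real n \<le> (\<Sum>i=1..n. excess_risk \<mu> (t i)) / real n"
    using n0 margin by (intro divide_right_mono sum_mono) auto
  also have "(\<Sum>i=1..n. p0 * a * (\<bar>t i\<bar> - 2 * a)) / real n = p0 * a * ((\<Sum>i=1..n. \<bar>t i\<bar>) / real n - 2 * a)"
    using n0 by (simp add: sum_distrib_left[symmetric] sum_subtractf diff_divide_distrib)
      (simp add: field_simps)
  finally have "p0 * a * ((\<Sum>i=1..n. \<bar>t i\<bar>) / real n - 2 * a) \<le> b + B * \<eta>" using ex by linarith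
  then have "(\<Sum>i=1..n. \<bar>t i\<bar>) / real n - 2 * a \<le> (b + B * \<eta>) / (p0 * a)"
    using pa by (simp add: pos_le_divide_eq mult.commute)
  then show ?thesis by (simp add: empirical_l1_loss_def t_def B_def)
qed

section \<open>Tail bounds and rates\<close>

lemma (in prob_space) sub_gaussian_imp_integrable:
  assumes W: "W \<in> borel_measurable M" and "sub_gaussian M W \<sigma>"
  shows "integrable M W"
proof -
  let ?c = "integral\<^sup>L M W"
  have "psi2_norm M W \<le> ereal \<sigma>" using assms(2) by (simp add: sub_gaussian_def)
  moreover have "(if integrable M (\<lambda>\<omega>. \<bar>W \<omega> - ?c\<bar> ^ 1)
     then ereal (real 1 powr (- 1 / 2) * (LINT \<omega>|M. \<bar>W \<omega> - ?c\<bar> ^ 1) powr (1 / real 1)) else \<infinity>) \<le> psi2_norm M W"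
    unfolding psi2_norm_def by (rule SUP_upper) simp
  ultimately have "integrable M (\<lambda>\<omega>. \<bar>W \<omega> - ?c\<bar> ^ 1)"
    by (auto split: if_splits)
  then have "integrable M (\<lambda>\<omega>. W \<omega> - ?c)" using W by (simp add: integrable_abs_iff)
  from Bochner_Integration.integrable_add[OF this integrable_const[of ?c]] show ?thesis by simp
qed

text \<open>Markov's inequality for the exponential moment; the factor \<open>sqrt d\<close> compares the Euclidean norm with the sup norm.\<close>

lemma (in prob_space) exponential_tail:
  fixes Z :: "'a \<Rightarrow> real ^ 'd"
  assumes Z [measurable]: "Z \<in> borel_measurable M" and \<alpha>: "\<alpha> > 0" and \<gamma>: "\<gamma> > 0"
    and int: "integrable M (\<lambda>\<omega>. exp (\<alpha> * infnorm (Z \<omega>) powr \<gamma>))" and s: "s > 0"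
  shows "prob {\<omega> \<in> space M. sqrt (real CARD('d)) * (s / \<alpha>) powr (1 / \<gamma>) < norm (Z \<omega>)}
    \<le> expectation (\<lambda>\<omega>. exp (\<alpha> * infnorm (Z \<omega>) powr \<gamma>)) * exp (- s)"
proof -
  let ?F = "\<lambda>\<omega>. exp (\<alpha> * infnorm (Z \<omega>) powr \<gamma>)"
  have [measurable]: "?F \<in> borel_measurable M" using int by simp
  have "{\<omega> \<in> space M. sqrt (real CARD('d)) * (s / \<alpha>) powr (1 / \<gamma>) < norm (Z \<omega>)} \<subseteq> {\<omega> \<in> space M. exp s \<le> ?F \<omega>}"
  proof clarsimp
    fix \<omega> assume "sqrt (real CARD('d)) * (s / \<alpha>) powr (1 / \<gamma>) < norm (Z \<omega>)"
    also have "norm (Z \<omega>) \<le> sqrt (real CARD('d)) * infnorm (Z \<omega>)"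
      using norm_le_infnorm[of "Z \<omega>"] by simp
    finally have "(s / \<alpha>) powr (1 / \<gamma>) < infnorm (Z \<omega>)" by simp
    then have "((s / \<alpha>) powr (1 / \<gamma>)) powr \<gamma> \<le> infnorm (Z \<omega>) powr \<gamma>"
      using \<gamma> by (intro powr_mono2) auto
    then have "s / \<alpha> \<le> infnorm (Z \<omega>) powr \<gamma>" using \<gamma> \<alpha> s by (simp add: powr_powr)
    then show "s \<le> \<alpha> * infnorm (Z \<omega>) powr \<gamma>" using \<alpha> by (simp add: field_simps)
  qed
  then have "prob {\<omega> \<in> space M. sqrt (real CARD('d)) * (s / \<alpha>) powr (1 / \<gamma>) < norm (Z \<omega>)} \<le> prob {\<omega> \<in> space M. exp s \<le> ?F \<omega>}"
    by (rule finite_measure_mono) measurable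
  also have "\<dots> \<le> expectation ?F / exp s"
    by (rule integral_Markov_inequality_measure[OF int]) auto
  finally show ?thesis by (simp add: exp_minus field_simps)
qed

lemma (in prob_space) prob_average_gt:
  fixes e :: "nat \<Rightarrow> 'a \<Rightarrow> real"
  assumes int: "\<And>i. i \<ge> 1 \<Longrightarrow> integrable M (e i)" and law: "\<And>i. i \<ge> 1 \<Longrightarrow> expectation (\<lambda>\<omega>. \<bar>e i \<omega>\<bar>) = m"
    and n: "n \<ge> 1" and K: "K > 0"
  shows "prob {\<omega> \<in> space M. K \<le> (\<Sum>i=1..n. \<bar>e i \<omega>\<bar>) / real n} \<le> m / K"
proof -
  have i: "integrable M (\<lambda>\<omega>. (\<Sum>i=1..n. \<bar>e i \<omega>\<bar>) / real n)"
    using int by (intro integrable_divide Bochner_Integration.integrable_sum integrable_abs) auto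
  have "prob {\<omega> \<in> space M. K \<le> (\<Sum>i=1..n. \<bar>e i \<omega>\<bar>) / real n} \<le> expectation (\<lambda>\<omega>. (\<Sum>i=1..n. \<bar>e i \<omega>\<bar>) / real n) / K"
    by (rule integral_Markov_inequality_measure[OF i]) (use K in \<open>auto intro!: AE_I2 divide_nonneg_nonneg sum_nonneg\<close>)
  also have "expectation (\<lambda>\<omega>. (\<Sum>i=1..n. \<bar>e i \<omega>\<bar>) / real n) = (\<Sum>i=1..n. m) / real n"
    using int law by (simp add: Bochner_Integration.integral_sum)
  finally show ?thesis using n by simp
qed

text \<open>The largest \<open>S\<close> with \<open>2^(S d) \<le> n\<close>: the entropy at the finest level is then of order \<open>n\<close>, and the finest
resolution \<open>4^(- S)\<close> is of order \<open>n^(- 2/d)\<close>.\<close>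

definition chain_depth :: "nat \<Rightarrow> nat \<Rightarrow> nat" where
  "chain_depth d n = nat \<lfloor>log 2 (real n) / real d\<rfloor>"

lemma chain_depth_le:
  assumes "d \<ge> 1" "n \<ge> 1"
  shows "2 ^ (chain_depth d n * d) \<le> real n"
proof -
  have "real (chain_depth d n) \<le> log 2 (real n) / real d"
    unfolding chain_depth_def using assms by (intro of_nat_floor) auto
  then have "real (chain_depth d n * d) \<le> log 2 (real n)" using assms by (simp add: field_simps)
  then have "2 powr real (chain_depth d n * d) \<le> real n" using assms by (subst powr_le_iff) auto
  then show ?thesis by (simp add: powr_realpow[symmetric])
qed

lemma chain_depth_resolution:
  assumes "d \<ge> 1" "n \<ge> 1"
  shows "1 / 4 ^ chain_depth d n \<le> 4 * real n powr (- 2 / real d)"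
proof -
  have "log 2 (real n) / real d \<le> real (chain_depth d n) + 1"
    unfolding chain_depth_def by linarith
  then have "real n \<le> 2 powr (real d * (real (chain_depth d n) + 1))"
    using assms by (subst log_le_iff[symmetric]) (auto simp: field_simps)
  then have "real n powr (2 / real d) \<le> (2 powr (real d * (real (chain_depth d n) + 1))) powr (2 / real d)"
    using assms by (intro powr_mono2) auto
  also have "\<dots> = 2 powr (2 * (real (chain_depth d n) + 1))"
  proof -
    have "real d * (real (chain_depth d n) + 1) * (2 / real d) = 2 * (real (chain_depth d n) + 1)"
      using assms by simp
    then show ?thesis by (simp only: powr_powr)
  qed
  also have "\<dots> = 2 powr real (2 * Suc (chain_depth d n))" by (simp add: algebra_simps)
  also have "\<dots> = 4 ^ Suc (chain_depth d n)"
    by (subst powr_realpow) (simp_all add: power_mult)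
  finally have *: "real n powr (2 / real d) \<le> 4 * 4 ^ chain_depth d n" by simp
  have "0 < real n powr (2 / real d)" using assms by simp
  with * have "1 / 4 ^ chain_depth d n \<le> 4 * (1 / real n powr (2 / real d))"
    by (simp add: field_simps)
  then show ?thesis by (simp add: powr_minus_divide)
qed

lemma filterlim_chain_depth:
  assumes "d \<ge> 1"
  shows "filterlim (chain_depth d) at_top at_top"
proof -
  have "filterlim (\<lambda>n. log 2 (real n) / real d) at_top at_top"
    using assms by real_asymp
  then have "filterlim (\<lambda>n. nat \<lfloor>log 2 (real n) / real d\<rfloor>) at_top at_top"
    by (intro filterlim_compose[OF filterlim_nat_sequentially] filterlim_compose[OF filterlim_floor_sequentially])
  then show ?thesis by (simp add: chain_depth_def[abs_def])
qed

lemma chaining_failure_tendsto_0: "(\<lambda>S::nat. 2 * real S * exp (- ((32/25) ^ S))) \<longlonglongrightarrow> 0"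
  by real_asymp

lemma rate_tendsto_0:
  fixes d c :: real
  assumes "d > 0"
  shows "(\<lambda>n. real n powr (- 1 / d) * ln (real n) powr c) \<longlonglongrightarrow> 0"
  using assms by real_asymp

text \<open>The noise contributes the scale of the functions on the truncation ball, of order
\<open>(ln n)^(1 + 1/\<gamma>)\<close>, times the finest resolution; this is at most a multiple of the radius of the transport ball.\<close>

lemma process_error_le_rate:
  fixes n d :: nat and C \<alpha> \<gamma> :: real
  assumes d: "d \<ge> 1" and n: "n \<ge> 1" "1 \<le> ln (real n)" and pos: "C > 0" "\<alpha> > 0" "\<gamma> > 0"
  shows "(real d * ln (real n)) * (sqrt (real d) * (2 * ln (real n) / \<alpha>) powr (1 / \<gamma>)) * (C / 4 ^ chain_depth d n)
    \<le> (4 * C * real d * sqrt (real d) * (2 / \<alpha>) powr (1 / \<gamma>))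
        * (real n powr (- 2 / real d) * ln (real n) powr (1 + 3 / \<gamma>))"
proof -
  have "(2 * ln (real n) / \<alpha>) powr (1 / \<gamma>) = (2 / \<alpha>) powr (1 / \<gamma>) * ln (real n) powr (1 / \<gamma>)"
    using pos n by (subst powr_mult[symmetric]) auto
  moreover have "ln (real n) * ln (real n) powr (1 / \<gamma>) = ln (real n) powr (1 + 1 / \<gamma>)"
    using n by (simp add: powr_add)
  ultimately have "(real d * ln (real n)) * (sqrt (real d) * (2 * ln (real n) / \<alpha>) powr (1 / \<gamma>)) * (C / 4 ^ chain_depth d n)
    = (C * real d * sqrt (real d) * (2 / \<alpha>) powr (1 / \<gamma>)) * (ln (real n) powr (1 + 1 / \<gamma>) * (1 / 4 ^ chain_depth d n))"
    by (simp add: algebra_simps)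
  also have "\<dots> \<le> (C * real d * sqrt (real d) * (2 / \<alpha>) powr (1 / \<gamma>))
      * (ln (real n) powr (1 + 3 / \<gamma>) * (4 * real n powr (- 2 / real d)))"
  proof (intro mult_left_mono mult_mono chain_depth_resolution)
    show "ln (real n) powr (1 + 1 / \<gamma>) \<le> ln (real n) powr (1 + 3 / \<gamma>)"
      using n pos by (intro powr_mono) (auto simp: divide_right_mono)
  qed (use d n pos in auto)
  finally show ?thesis by (simp add: mult_ac)
qed

lemma radius_eventually_ge:
  fixes a b :: real
  assumes "a > 0" "b > 0" "c > 0"
  shows "eventually (\<lambda>n. 1 \<le> c * (2 * ln (real n) / a) powr b) sequentially"
  using assms by real_asymp

section \<open>Consistency rate of the robust estimator\<close>

theorem theorem2:
  fixes M :: "'w measure"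
    and X :: "nat \<Rightarrow> 'w \<Rightarrow> real ^ 'd"
    and Y \<E> :: "nat \<Rightarrow> 'w \<Rightarrow> real"
    and f\<^sub>0 :: "real ^ 'd \<Rightarrow> real"
    and \<alpha> \<gamma> \<sigma> :: real
  assumes "prob_space M"
    and "CARD('d) > 4"
    and indep: "prob_space.indep_vars M (\<lambda>_. borel) (\<lambda>i \<omega>. (X i \<omega>, Y i \<omega>)) {1..}"
    and ident: "\<forall>i\<ge>1. distr M borel (\<lambda>\<omega>. (X i \<omega>, Y i \<omega>)) = distr M borel (\<lambda>\<omega>. (X 1 \<omega>, Y 1 \<omega>))"
    and model: "\<forall>i\<ge>1. \<forall>\<omega>\<in>space M. Y i \<omega> = f\<^sub>0 (X i \<omega>) + \<E> i \<omega>"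
    and "convex_on UNIV f\<^sub>0" "grad_sup_norm f\<^sub>0 < \<infinity>"
    and noise_indep: "\<forall>i\<ge>1. indep_rvs M (\<E> i) (X i)"
    and "\<alpha> > 0" "\<gamma> > 0"
    and tail: "integrable M (\<lambda>\<omega>. exp (\<alpha> * infnorm (X 1 \<omega>) powr \<gamma>))"
    and "\<sigma> > 0" "sub_gaussian M (\<E> 1) \<sigma>"
    and "symmetric_about_zero (distr M borel (\<E> 1))"
    and "continuous_positive_density_near_zero (distr M borel (\<E> 1))"
  shows "\<exists>\<delta> :: nat \<Rightarrow> real. (\<forall>n. 0 \<le> \<delta> n) \<and>
      \<delta> \<in> \<Theta>(\<lambda>n. real n powr (- 2 / real CARD('d)) * ln (real n) powr (1 + 3 / \<gamma>)) \<and>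
      (\<forall>ghat :: nat \<Rightarrow> 'w \<Rightarrow> real ^ 'd \<Rightarrow> real.
         (\<forall>n\<ge>1. \<forall>x. (\<lambda>\<omega>. ghat n \<omega> x) \<in> borel_measurable M) \<longrightarrow>
         (\<forall>n\<ge>1. \<forall>\<omega>\<in>space M.
            is_arg_min
              (worst_case_risk (\<delta> n) (empirical_measure n (\<lambda>i. (X i \<omega>, Y i \<omega>))))
              (\<lambda>f. f \<in> lipschitz_convex_class n) (ghat n \<omega>)) \<longrightarrow>
         (\<exists>C>0. (\<lambda>n. measure M {\<omega> \<in> space M.
                    empirical_l1_loss n (\<lambda>i. X i \<omega>) (ghat n \<omega>) f\<^sub>0 >
                      C * real n powr (- 1 / real CARD('d))
                        * ln (real n) powr ((\<gamma> + 3) / (2 * \<gamma>))})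
                 \<longlonglongrightarrow> 0))"
proof -
  interpret prob_space M by fact
  define d where "d = CARD('d)"
  have d: "d \<ge> 5" "d \<ge> 1" using \<open>CARD('d) > 4\<close> by (auto simp: d_def)
  note conv = \<open>convex_on UNIV f\<^sub>0\<close>
  obtain L where L: "L > 0" "grad_sup_norm f\<^sub>0 \<le> ereal L"
  proof (cases "grad_sup_norm f\<^sub>0")
    case (real r)
    then show ?thesis using that[of "max r 1"] by simp
  next
    case MInf
    then show ?thesis using that[of 1] by simp
  qed (use \<open>grad_sup_norm f\<^sub>0 < \<infinity>\<close> in simp)
  have lip1: "\<bar>f\<^sub>0 x - f\<^sub>0 y\<bar> \<le> L * l1_norm (x - y)" for x y
    by (rule grad_sup_norm_imp_lipschitz[OF conv L(2)])
  have lip2: "\<bar>f\<^sub>0 x - f\<^sub>0 y\<bar> \<le> L * real d * norm (x - y)" for x y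
    unfolding d_def using L by (intro euclidean_lipschitz lip1) simp
  have f0_meas [measurable]: "f\<^sub>0 \<in> borel_measurable borel" by (rule borel_measurable_lipschitz[OF lip2])

  define e where "e i \<omega> = Y i \<omega> - f\<^sub>0 (X i \<omega>)" for i \<omega>
  have eE: "e i \<omega> = \<E> i \<omega>" if "i \<ge> 1" "\<omega> \<in> space M" for i \<omega>
    using model that by (simp add: e_def)
  have XYm [measurable]: "(\<lambda>\<omega>. (X i \<omega>, Y i \<omega>)) \<in> borel_measurable M" if "i \<ge> 1" for i
    using indep that by (auto simp: indep_vars_def2)
  have Xm [measurable]: "X i \<in> borel_measurable M" and Em: "\<E> i \<in> borel_measurable M" if "i \<ge> 1" for i
    using noise_indep that by (auto simp: indep_rvs_def)
  have em [measurable]: "e i \<in> borel_measurable M" if "i \<ge> 1" for i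
    using Em[OF that] eE[OF that] by (subst measurable_cong[of M "e i" "\<E> i"]) auto
  have noise: "indep_rvs M (e i) (X i)" if "i \<ge> 1" for i
  proof -
    have "e i -` A \<inter> space M = \<E> i -` A \<inter> space M" for A using eE[OF that] by auto
    then show ?thesis using noise_indep that em[OF that] unfolding indep_rvs_def by simp
  qed
  have split_m: "(\<lambda>(x, y). (x, y - f\<^sub>0 x)) \<in> borel_measurable (borel :: ((real ^ 'd) \<times> real) measure)"
    and res_m: "(\<lambda>(x, y). y - f\<^sub>0 x) \<in> borel_measurable (borel :: ((real ^ 'd) \<times> real) measure)"
    and fst_m: "fst \<in> borel_measurable (borel :: ((real ^ 'd) \<times> real) measure)"
    unfolding borel_prod[symmetric] by measurable
  have indep_Xe: "indep_vars (\<lambda>_. borel) (\<lambda>i \<omega>. (X i \<omega>, e i \<omega>)) {1..}"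
    using indep_vars_compose2[OF indep, of "\<lambda>_ (x, y). (x, y - f\<^sub>0 x)" "\<lambda>_. borel"] split_m by (simp add: e_def)
  define \<mu> where "\<mu> = distr M borel (e 1)"
  have law_e: "distr M borel (e i) = \<mu>" if "i \<ge> 1" for i
  proof -
    have eq: "distr M borel (e k) = distr (distr M borel (\<lambda>\<omega>. (X k \<omega>, Y k \<omega>))) borel (\<lambda>(x, y). y - f\<^sub>0 x)" if "k \<ge> 1" for k
      by (subst distr_distr[OF res_m XYm[OF that]]) (simp add: comp_def e_def[abs_def])
    show ?thesis unfolding \<mu>_def eq[OF that] eq[OF order_refl] ident[rule_format, OF that] ..
  qed
  have law_X: "distr M borel (X i) = distr M borel (X 1)" if "i \<ge> 1" for i
  proof -
    have eq: "distr M borel (X k) = distr (distr M borel (\<lambda>\<omega>. (X k \<omega>, Y k \<omega>))) borel fst" if "k \<ge> 1" for k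
      by (subst distr_distr[OF fst_m XYm[OF that]]) (simp add: comp_def)
    show ?thesis unfolding eq[OF that] eq[OF order_refl] ident[rule_format, OF that] ..
  qed
  have \<mu>E: "\<mu> = distr M borel (\<E> 1)" unfolding \<mu>_def by (rule distr_cong) (use eE in auto)
  have \<mu>: "prob_space \<mu>" "sets \<mu> = sets borel" unfolding \<mu>_def by (auto intro: prob_space_distr em)
  have sym: "symmetric_about_zero \<mu>" and dens: "continuous_positive_density_near_zero \<mu>"
    using \<open>symmetric_about_zero (distr M borel (\<E> 1))\<close>
      \<open>continuous_positive_density_near_zero (distr M borel (\<E> 1))\<close> unfolding \<mu>E .
  obtain p0 a0 where p0: "p0 > 0" and a0: "a0 > 0" and mass: "\<And>a. 0 < a \<Longrightarrow> a \<le> a0 \<Longrightarrow> p0 * a \<le> measure \<mu> {0<..a}"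
    using measure_near_zero_ge[OF \<mu>(1) dens] by blast

  have "integrable M (\<E> 1)" by (rule sub_gaussian_imp_integrable[OF Em[OF order_refl] \<open>sub_gaussian M (\<E> 1) \<sigma>\<close>])
  then have "integrable M (e 1)" using eE[of 1] by (subst Bochner_Integration.integrable_cong[of M M "e 1" "\<E> 1"]) auto
  then have \<mu>_int: "integrable \<mu> (\<lambda>t. t)" unfolding \<mu>_def by (subst integrable_distr_eq) (auto intro: em)
  have e_int: "integrable M (e i)" if "i \<ge> 1" for i
    using \<mu>_int unfolding law_e[OF that, symmetric] by (subst (asm) integrable_distr_eq) (auto intro: em that)
  define m where "m = (\<integral>t. \<bar>t\<bar> \<partial>\<mu>)"
  have e_mean: "expectation (\<lambda>\<omega>. \<bar>e i \<omega>\<bar>) = m" if "i \<ge> 1" for i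
    unfolding m_def law_e[OF that, symmetric] by (subst integral_distr) (auto intro: em that)

  let ?F = "\<lambda>x :: real ^ 'd. exp (\<alpha> * infnorm x powr \<gamma>)"
  have [measurable]: "infnorm \<in> borel_measurable (borel :: (real ^ 'd) measure)"
    by (intro borel_measurable_continuous_onI continuous_on_infnorm continuous_on_id)
  have F_meas: "?F \<in> borel_measurable borel" by measurable
  define \<tau> where "\<tau> = expectation (\<lambda>\<omega>. ?F (X 1 \<omega>))"
  have tail_i: "integrable M (\<lambda>\<omega>. ?F (X i \<omega>))" "expectation (\<lambda>\<omega>. ?F (X i \<omega>)) = \<tau>" if "i \<ge> 1" for i
  proof -
    have "integrable (distr M borel (X i)) ?F"
      unfolding law_X[OF that] using tail F_meas by (subst integrable_distr_eq) (auto intro: Xm)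
    then show "integrable M (\<lambda>\<omega>. ?F (X i \<omega>))"
      using F_meas by (subst (asm) integrable_distr_eq) (auto intro: Xm that)
    have "(\<integral>x. ?F x \<partial>distr M borel (X k)) = expectation (\<lambda>\<omega>. ?F (X k \<omega>))" if "k \<ge> 1" for k
      using F_meas by (subst integral_distr) (auto intro: Xm that)
    from this[OF that] this[of 1] show "expectation (\<lambda>\<omega>. ?F (X i \<omega>)) = \<tau>"
      unfolding law_X[OF that] \<tau>_def by simp
  qed

  \<comment> \<open>The radius of the transport ball is the square of the rate to be proved.\<close>
  define r where "r n = real n powr (- 1 / real d) * ln (real n) powr ((\<gamma> + 3) / (2 * \<gamma>))" for n
  define \<delta> where "\<delta> n = real n powr (- 2 / real d) * ln (real n) powr (1 + 3 / \<gamma>)" for n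
  have \<delta>_r: "\<delta> n = r n * r n" for n
  proof -
    have "(\<gamma> + 3) / (2 * \<gamma>) + (\<gamma> + 3) / (2 * \<gamma>) = 1 + 3 / \<gamma>" using \<open>\<gamma> > 0\<close> by (simp add: field_simps)
    moreover have "r n * r n = real n powr (- 1 / real d + - 1 / real d)
        * ln (real n) powr ((\<gamma> + 3) / (2 * \<gamma>) + (\<gamma> + 3) / (2 * \<gamma>))"
      by (simp only: r_def powr_add) (simp add: mult_ac)
    ultimately show ?thesis by (simp add: \<delta>_def)
  qed
  have r_lim: "r \<longlonglongrightarrow> 0" unfolding r_def[abs_def] using d by (intro rate_tendsto_0) simp
  have \<delta>_lim: "\<delta> \<longlonglongrightarrow> 0" using tendsto_mult[OF r_lim r_lim] by (simp add: \<delta>_r[abs_def])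

  \<comment> \<open>With exponent \<open>2 ln n\<close> in the tail bound, all \<open>n\<close> covariates lie in the ball of radius \<open>R n\<close>, up to probability of order \<open>1/n\<close>.\<close>
  define R where "R n = sqrt (real d) * (2 * ln (real n) / \<alpha>) powr (1 / \<gamma>)" for n
  \<comment> \<open>Euclidean Lipschitz constant of the functions over which the estimator minimises.\<close>
  define l where "l n = real d * ln (real n)" for n
  obtain C where chaining_C: "C > 0 \<and> (\<forall>(M :: 'w measure) n S V (g0 :: real ^ 'd \<Rightarrow> real).
    prob_space M \<longrightarrow> subgaussian_process M n V \<longrightarrow> g0 \<in> unit_convex_class \<longrightarrow> 2 ^ (S * CARD('d)) \<le> real n \<longrightarrow>
    (\<exists>E\<in>sets M. measure M E \<le> 2 * real S * exp (- ((32/25) ^ S)) \<and>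
      (\<forall>\<omega>\<in>space M - E. \<forall>g\<in>unit_convex_class. \<bar>V g \<omega> - V g0 \<omega>\<bar> \<le> C / 4 ^ S)))"
    using chaining[OF d(1)[unfolded d_def], where 'w='w] by (rule exE)
  note C = chaining_C[THEN conjunct1]
  note chain = chaining_C[THEN conjunct2, folded d_def, rule_format]
  define K where "K = 4 * C * real d * sqrt (real d) * (2 / \<alpha>) powr (1 / \<gamma>)"
  have K: "K > 0" using C d \<open>\<alpha> > 0\<close> by (simp add: K_def)
  \<comment> \<open>The factor of \<open>r n\<close> in \<open>l1_loss_bound\<close> for \<open>a = r n\<close>, where \<open>b = 2 \<delta> L\<close>, the noise is at most \<open>K \<delta>\<close>, and \<open>\<delta> = r\<^sup>2\<close>.\<close>
  define C' where "C' = 2 + (2 * L + K) / p0"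
  have C': "C' > 0" using L K p0 by (simp add: C'_def add_pos_pos)
  define q where "q n = \<tau> / real n + m / ln (real n)
    + 2 * real (chain_depth d n) * exp (- ((32/25) ^ chain_depth d n))" for n
  have q_lim: "q \<longlonglongrightarrow> 0"
  proof -
    have "(\<lambda>n. \<tau> / real n) \<longlonglongrightarrow> 0" "(\<lambda>n. m / ln (real n)) \<longlonglongrightarrow> 0" by real_asymp+
    moreover have "(\<lambda>n. 2 * real (chain_depth d n) * exp (- ((32/25) ^ chain_depth d n))) \<longlonglongrightarrow> 0"
      by (rule filterlim_compose[OF chaining_failure_tendsto_0 filterlim_chain_depth[OF d(2)]])
    ultimately have "q \<longlonglongrightarrow> 0 + 0 + 0" unfolding q_def[abs_def] by (intro tendsto_add)
    then show ?thesis by simp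
  qed
  define good where "good n \<longleftrightarrow> n \<ge> 1 \<and> 1 + \<bar>f\<^sub>0 0\<bar> \<le> ln (real n) \<and> L \<le> ln (real n) \<and> 1 \<le> R n
    \<and> 2 * \<delta> n * L \<le> 1 \<and> r n \<le> a0" for n
  have good: "eventually good sequentially"
  proof -
    have "eventually (\<lambda>n. 1 + \<bar>f\<^sub>0 0\<bar> \<le> ln (real n)) sequentially" "eventually (\<lambda>n. L \<le> ln (real n)) sequentially"
      by real_asymp+
    moreover have "eventually (\<lambda>n. 1 \<le> R n) sequentially"
      unfolding R_def using d \<open>\<alpha> > 0\<close> \<open>\<gamma> > 0\<close> by (intro radius_eventually_ge) auto
    moreover have "eventually (\<lambda>n. \<delta> n < 1 / (2 * L)) sequentially" "eventually (\<lambda>n. r n < a0) sequentially"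
      using order_tendstoD(2)[OF \<delta>_lim] order_tendstoD(2)[OF r_lim] L a0 by auto
    ultimately show ?thesis using eventually_ge_at_top[of 1]
    proof eventually_elim
      case (elim n)
      then show ?case using L by (simp add: good_def field_simps)
    qed
  qed

  have main: "measure M {\<omega> \<in> space M. empirical_l1_loss n (\<lambda>i. X i \<omega>) (g \<omega>) f\<^sub>0 > C' * r n} \<le> q n"
    if n: "good n" and g: "\<And>\<omega>. \<omega> \<in> space M \<Longrightarrow>
      is_arg_min (worst_case_risk (\<delta> n) (empirical_measure n (\<lambda>i. (X i \<omega>, Y i \<omega>)))) (\<lambda>f. f \<in> lipschitz_convex_class n) (g \<omega>)"
    for n and g :: "'w \<Rightarrow> real ^ 'd \<Rightarrow> real"
  proof -
    have n1: "n \<ge> 1" and lnn: "1 + \<bar>f\<^sub>0 0\<bar> \<le> ln (real n)" "L \<le> ln (real n)" and Rn: "1 \<le> R n"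
      and \<delta>n: "2 * \<delta> n * L \<le> 1" and rn: "r n \<le> a0" using n by (auto simp: good_def)
    have ln1: "1 \<le> ln (real n)" using lnn by linarith
    have "ln (real n) > 0" using ln1 by linarith
    then have rpos: "r n > 0" unfolding r_def using n1 by (intro mult_pos_pos) auto
    then have \<delta>pos: "\<delta> n > 0" by (simp add: \<delta>_r)
    have lpos: "l n > 0" using d ln1 by (simp add: l_def)
    define B where "B = l n * R n"
    have Bpos: "B > 0" using lpos Rn by (simp add: B_def)
    have B5: "5 * ln (real n) \<le> B"
    proof -
      have "5 * ln (real n) * 1 \<le> l n * R n" unfolding l_def using d ln1 Rn by (intro mult_mono) auto
      then show ?thesis by (simp add: B_def)
    qed
    \<comment> \<open>The rescaled regression function; its noise process vanishes, so deviations from it are the noise itself.\<close>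
    define g0 where "g0 = (\<lambda>u. f\<^sub>0 (R n *\<^sub>R u) / B)"
    have lip_n: "\<bar>f\<^sub>0 x - f\<^sub>0 y\<bar> \<le> l n * norm (x - y)" for x y
    proof -
      have "L * real d * norm (x - y) \<le> l n * norm (x - y)"
        unfolding l_def mult.commute[of L] using lnn(2) by (intro mult_right_mono mult_left_mono) auto
      then show ?thesis using lip2[of x y] by linarith
    qed
    have g0: "g0 \<in> unit_convex_class"
      unfolding g0_def
    proof (rule rescaled_in_unit_convex_class[OF conv])
      show "\<bar>f\<^sub>0 x - f\<^sub>0 y\<bar> \<le> B / R n * norm (x - y)" for x y using lip_n Rn by (simp add: B_def)
      show "\<bar>f\<^sub>0 0\<bar> \<le> 4 * B" using B5 lnn ln1 by linarith
    qed (use Rn Bpos in auto)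
    define V where "V = noise_process \<mu> (R n) B g0 n X e"
    have V: "subgaussian_process M n V"
      unfolding V_def by (rule subgaussian_noise_process[OF indep_Xe noise law_e]) (use Rn Bpos n1 g0 in auto)
    obtain E3 where E3: "E3 \<in> sets M"
      and E3': "measure M E3 \<le> 2 * real (chain_depth d n) * exp (- ((32/25) ^ chain_depth d n)) \<and>
        (\<forall>\<omega>\<in>space M - E3. \<forall>h\<in>unit_convex_class. \<bar>V h \<omega> - V g0 \<omega>\<bar> \<le> C / 4 ^ chain_depth d n)"
      using chain[OF prob_space_axioms V g0 chain_depth_le[OF d(2) n1]] by (rule bexE)
    note PE3 = E3'[THEN conjunct1]
    note E3_bound = E3'[THEN conjunct2, THEN bspec, THEN bspec]
    \<comment> \<open>The three exceptional events: a covariate far out, large noise on average, a broken chain (\<open>E3\<close>).\<close>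
    define E1 where "E1 = (\<Union>i\<in>{1..n}. {\<omega> \<in> space M. R n < norm (X i \<omega>)})"
    define E2 where "E2 = {\<omega> \<in> space M. ln (real n) \<le> (\<Sum>i=1..n. \<bar>e i \<omega>\<bar>) / real n}"
    have E1_i: "{\<omega> \<in> space M. R n < norm (X i \<omega>)} \<in> sets M" if "i \<ge> 1" for i
    proof -
      note [measurable] = Xm[OF that]
      show ?thesis by measurable
    qed
    have E1: "E1 \<in> sets M" unfolding E1_def using E1_i by (intro sets.finite_UN) auto
    have E2: "E2 \<in> sets M"
    proof -
      have "(\<lambda>\<omega>. (\<Sum>i=1..n. \<bar>e i \<omega>\<bar>) / real n) \<in> borel_measurable M"
        using em by (intro borel_measurable_divide borel_measurable_sum borel_measurable_abs) auto
      then show ?thesis unfolding E2_def by measurable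
    qed
    have PE1: "measure M E1 \<le> \<tau> / real n"
    proof -
      have "measure M E1 \<le> (\<Sum>i=1..n. prob {\<omega> \<in> space M. R n < norm (X i \<omega>)})"
        unfolding E1_def using E1_i by (intro measure_UNION_le) auto
      also have "\<dots> \<le> (\<Sum>i=1..n. \<tau> * exp (- (2 * ln (real n))))"
      proof (rule sum_mono)
        fix i assume "i \<in> {1..n}"
        then have i: "i \<ge> 1" by simp
        have "2 * ln (real n) > 0" using ln1 by simp
        from exponential_tail[OF Xm[OF i] \<open>\<alpha> > 0\<close> \<open>\<gamma> > 0\<close> tail_i(1)[OF i] this]
        show "prob {\<omega> \<in> space M. R n < norm (X i \<omega>)} \<le> \<tau> * exp (- (2 * ln (real n)))"
          unfolding tail_i(2)[OF i] R_def d_def .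
      qed
      also have "\<dots> = real n * (\<tau> * (1 / (real n * real n)))"
      proof -
        have "exp (- (2 * ln (real n))) = exp (- ln (real n)) * exp (- ln (real n))"
          by (subst exp_add[symmetric]) simp
        also have "\<dots> = 1 / (real n * real n)" using n1 by (simp add: exp_minus inverse_eq_divide)
        finally show ?thesis by simp
      qed
      also have "\<dots> = \<tau> / real n" using n1 by (simp add: field_simps)
      finally show ?thesis .
    qed
    have PE2: "measure M E2 \<le> m / ln (real n)"
      unfolding E2_def by (intro prob_average_gt e_int e_mean n1 order_less_le_trans[OF zero_less_one ln1])
    have "{\<omega> \<in> space M. empirical_l1_loss n (\<lambda>i. X i \<omega>) (g \<omega>) f\<^sub>0 > C' * r n} \<subseteq> E1 \<union> E2 \<union> E3"
    proof (rule subsetI, rule ccontr)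
      fix \<omega> assume big: "\<omega> \<in> {\<omega> \<in> space M. empirical_l1_loss n (\<lambda>i. X i \<omega>) (g \<omega>) f\<^sub>0 > C' * r n}"
        and out: "\<omega> \<notin> E1 \<union> E2 \<union> E3"
      then have \<omega>: "\<omega> \<in> space M" by simp
      have gF: "g \<omega> \<in> lipschitz_convex_class n"
        and not_less: "\<not> worst_case_risk (\<delta> n) (empirical_measure n (\<lambda>i. (X i \<omega>, Y i \<omega>))) f\<^sub>0
          < worst_case_risk (\<delta> n) (empirical_measure n (\<lambda>i. (X i \<omega>, Y i \<omega>))) (g \<omega>)"
      proof -
        have "f\<^sub>0 \<in> lipschitz_convex_class n"
          using conv L(2) lnn by (auto simp: lipschitz_convex_class_def intro: order_trans)
        with g[OF \<omega>] show "g \<omega> \<in> lipschitz_convex_class n"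
          "\<not> worst_case_risk (\<delta> n) (empirical_measure n (\<lambda>i. (X i \<omega>, Y i \<omega>))) f\<^sub>0
          < worst_case_risk (\<delta> n) (empirical_measure n (\<lambda>i. (X i \<omega>, Y i \<omega>))) (g \<omega>)"
          by (auto simp: is_arg_min_def)
      qed
      have gconv: "convex_on UNIV (g \<omega>)" using gF by (simp add: lipschitz_convex_class_def)
      have glip: "\<bar>g \<omega> x - g \<omega> y\<bar> \<le> l n * norm (x - y)" for x y
      proof -
        have "\<bar>g \<omega> x - g \<omega> y\<bar> \<le> ln (real n) * l1_norm (x - y)" for x y
          by (rule grad_sup_norm_imp_lipschitz[OF gconv]) (use gF in \<open>simp add: lipschitz_convex_class_def\<close>)
        from euclidean_lipschitz[OF this, of x y] ln1 show ?thesis by (simp add: l_def d_def mult_ac)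
      qed
      have "empirical_l1_loss n (\<lambda>i. X i \<omega>) (g \<omega>) f\<^sub>0
          \<le> 2 * r n + (2 * \<delta> n * L + l n * R n * (C / 4 ^ chain_depth d n)) / (p0 * r n)"
      proof (rule l1_loss_bound[OF n1 lpos _ gconv glip lip_n])
        show "R n > 0" using Rn by simp
        show "norm (X i \<omega>) \<le> R n" if "i \<in> {1..n}" for i 
          by (rule ccontr) (use out \<omega> that in \<open>auto simp: E1_def not_le\<close>)
        show "(\<Sum>i=1..n. \<bar>e i \<omega>\<bar>) / real n \<le> ln (real n)" 
          by (rule ccontr) (use out \<omega> in \<open>auto simp: E2_def\<close>)
        show "2 * ln (real n) + 2 * \<delta> n * L + \<bar>f\<^sub>0 0\<bar> \<le> 2 * (l n * R n)"
          using B5 \<delta>n lnn ln1 unfolding B_def by linarith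
        have "(\<Sum>i=1..n. \<bar>Y i \<omega> - g \<omega> (X i \<omega>)\<bar>) / real n \<le> (\<Sum>i=1..n. \<bar>Y i \<omega> - f\<^sub>0 (X i \<omega>)\<bar>) / real n + 2 * \<delta> n * L"
          using dro_minimizer_risk_le[OF n1 leI[OF not_less] lip1 f0_meas borel_measurable_lipschitz[OF glip] L(1) \<delta>pos]
          by simp
        then show "(\<Sum>i=1..n. \<bar>e i \<omega> - (g \<omega> (X i \<omega>) - f\<^sub>0 (X i \<omega>))\<bar>) / real n
            \<le> (\<Sum>i=1..n. \<bar>e i \<omega>\<bar>) / real n + 2 * \<delta> n * L"
          by (simp add: e_def)
        show "\<bar>noise_process \<mu> (R n) (l n * R n) (\<lambda>u. f\<^sub>0 (R n *\<^sub>R u) / (l n * R n)) n X e h \<omega>\<bar>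
            \<le> C / 4 ^ chain_depth d n" if "h \<in> unit_convex_class" for h
        proof -
          have "truncated_error (R n) B g0 g0 x = 0" for x by (simp add: truncated_error_def)
          then have "V g0 \<omega> = 0" by (simp add: V_def noise_process_def centred_loss_def)
          with E3_bound[of \<omega> h] out \<omega> that show ?thesis by (simp add: V_def g0_def B_def)
        qed
        show "p0 * r n > 0" using p0 rpos by simp
        show "p0 * r n * (\<bar>t\<bar> - 2 * r n) \<le> excess_risk \<mu> t" for t
        proof (cases "2 * r n \<le> \<bar>t\<bar>")
          case True
          have "p0 * r n * (\<bar>t\<bar> - 2 * r n) \<le> measure \<mu> {0<..r n} * (\<bar>t\<bar> - 2 * r n)"
            using mass[OF rpos rn] True by (intro mult_right_mono) auto
          then show ?thesis using excess_risk_ge[OF \<mu> sym, of "r n" t] rpos by (simp add: mult.commute)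
        next
          case False
          then have "p0 * r n * (\<bar>t\<bar> - 2 * r n) \<le> 0" using p0 rpos by (intro mult_nonneg_nonpos) auto
          moreover have "0 \<le> excess_risk \<mu> t" using excess_risk_ge[OF \<mu> sym, of 0 t] by simp
          ultimately show ?thesis by linarith
        qed
      qed
      also have "\<dots> \<le> 2 * r n + (2 * \<delta> n * L + K * \<delta> n) / (p0 * r n)"
        using process_error_le_rate[OF d(2) n1 ln1 C \<open>\<alpha> > 0\<close> \<open>\<gamma> > 0\<close>] p0 rpos
        by (intro add_left_mono divide_right_mono) (auto simp: l_def R_def K_def \<delta>_def)
      also have "\<dots> = C' * r n"
        using p0 rpos by (simp add: \<delta>_r C'_def field_simps)
      finally show False using big by simp
    qed
    then have "measure M {\<omega> \<in> space M. empirical_l1_loss n (\<lambda>i. X i \<omega>) (g \<omega>) f\<^sub>0 > C' * r n} \<le> measure M (E1 \<union> E2 \<union> E3)"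
      using E1 E2 E3 by (intro finite_measure_mono) auto
    also have "\<dots> \<le> measure M E1 + measure M E2 + measure M E3"
      using measure_Un_le[of "E1 \<union> E2" M E3] measure_Un_le[of E1 M E2] E1 E2 E3 by auto
    also have "\<dots> \<le> q n" unfolding q_def using PE1 PE2 PE3 by linarith
    finally show ?thesis .
  qed

  show ?thesis
  proof (intro exI[of _ \<delta>] conjI allI impI)
    show "0 \<le> \<delta> n" for n by (simp add: \<delta>_def)
    show "\<delta> \<in> \<Theta>(\<lambda>n. real n powr (- 2 / real CARD('d)) * ln (real n) powr (1 + 3 / \<gamma>))"
      by (simp add: \<delta>_def[abs_def] d_def)
    fix ghat :: "nat \<Rightarrow> 'w \<Rightarrow> real ^ 'd \<Rightarrow> real"
    assume ghat: "\<forall>n\<ge>1. \<forall>\<omega>\<in>space M. is_arg_min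
      (worst_case_risk (\<delta> n) (empirical_measure n (\<lambda>i. (X i \<omega>, Y i \<omega>))))
      (\<lambda>f. f \<in> lipschitz_convex_class n) (ghat n \<omega>)"
    let ?P = "\<lambda>n. measure M {\<omega> \<in> space M. empirical_l1_loss n (\<lambda>i. X i \<omega>) (ghat n \<omega>) f\<^sub>0 > C' * r n}"
    have le: "eventually (\<lambda>n. ?P n \<le> q n) sequentially"
      using good
    proof eventually_elim
      case (elim n)
      then have "n \<ge> 1" by (simp add: good_def)
      with ghat show ?case by (intro main[OF elim]) auto
    qed
    have "?P \<longlonglongrightarrow> 0"
      by (rule tendsto_sandwich[OF _ le tendsto_const q_lim]) simp
    then show "\<exists>C>0. (\<lambda>n. measure M {\<omega> \<in> space M.
                    empirical_l1_loss n (\<lambda>i. X i \<omega>) (ghat n \<omega>) f\<^sub>0 >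
                      C * real n powr (- 1 / real CARD('d))
                        * ln (real n) powr ((\<gamma> + 3) / (2 * \<gamma>))}) \<longlonglongrightarrow> 0"
      using C' by (intro exI[of _ C']) (simp add: r_def d_def mult.assoc)
  qed
qed

end
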